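(* The graph Laplace operator $\Delta$ is self-adjoint in the Hilbert space $L^2(\mu)$; that is, the densely defined symmetric operator $\Delta$ with domain $\mathcal D_{\mathrm{fin}}$ is essentially self-adjoint in $L^2(\mu)$.
   Context: $(V,\mathcal B,\mu)$ is a standard Borel space with a non-atomic infinite $\sigma$-finite measure $\mu$. $\rho$ is a $\sigma$-finite symmetric measure on $(V\times V,\mathcal B\times\mathcal B)$, i.e. $\rho(A\times B)=\rho(B\times A)$ for all $A,B\in\mathcal B$, supported by a symmetric Borel set $E\subset V\times V$, and disintegrated with respect to $\mu$: there is a measurable family $x\mapsto\rho_x$ of measures on $(V,\mathcal B)$, with $\rho_x$ supported by $E_x=\{y:(x,y)\in E\}$, such that $\iint f\,d\rho=\int_V\big(\int_V f(x,y)\,d\rho_x(y)\big)d\mu(x)$. The measure $\rho$ is irreducible: for $\mu$-a.e. $x$, $E_x$ is nonempty and uncountable and $(E_x,\rho_x)$ is a standard (non-atomic) measure space. Put $c(x)=\rho_x(V)$; it is assumed that $0<c(x)<\infty$ for $\mu$-a.e. $x$ and $\int_A c\,d\mu<\infty$ whenever $\mu(A)<\infty$. It is also assumed that, for every $A$ with $\mu(A)<\infty$, the function $x\mapsto\rho_x(A)$ belongs to $L^1(\mu)\cap L^2(\mu)$. The graph Laplace operator is $\Delta(f)(x)=\int_V(f(x)-f(y))\,d\rho_x(y)$, considered as a densely defined operator in $L^2(\mu)$ on $\mathcal D_{\mathrm{fin}}=\mathrm{Span}\{\chi_A:A\in\mathcal B,\ \mu(A)<\infty\}$ (the paper takes it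 that $\Delta$ maps $\mathcal D_{\mathrm{fin}}$ into $L^2(\mu)$). *)

theory Defs
  imports "HOL-Analysis.Analysis"
begin

section \<open>Standard Borel spaces and non-atomic measures\<close>

definition standard_borel_space :: "'a measure \<Rightarrow> bool" where
  "standard_borel_space M \<longleftrightarrow>
     (\<exists>X. completely_metrizable_space X \<and> second_countable X \<and> topspace X = space M \<and>
          sets M = sigma_sets (topspace X) {U. openin X U})"

definition nonatomic :: "'a measure \<Rightarrow> bool" where
  "nonatomic M \<longleftrightarrow>
     (\<forall>A\<in>sets M. 0 < emeasure M A \<longrightarrow>
        (\<exists>B\<in>sets M. B \<subseteq> A \<and> 0 < emeasure M B \<and> emeasure M B < emeasure M A))"


section \<open>The Hilbert space of square-integrable functions and its unbounded operators\<close>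

text \<open>
  The elements of the Hilbert space are represented by square-integrable complex functions,
  two of which stand for the same vector when they agree almost everywhere.  An unbounded operator
  is given by its graph, a set of pairs of representatives that is invariant under changes on
  null sets.  Equality of two such graphs is therefore equality of the operators, including
  their domains.
\<close>

definition L2 :: "'a measure \<Rightarrow> ('a \<Rightarrow> complex) set" where
  "L2 M = {f \<in> borel_measurable M. integrable M (\<lambda>x. (cmod (f x))\<^sup>2)}"

definition l2_inner :: "'a measure \<Rightarrow> ('a \<Rightarrow> complex) \<Rightarrow> ('a \<Rightarrow> complex) \<Rightarrow> complex" where
  "l2_inner M f g = (\<integral>x. f x * cnj (g x) \<partial>M)"

definition l2_dist :: "'a measure \<Rightarrow> ('a \<Rightarrow> complex) \<Rightarrow> ('a \<Rightarrow> complex) \<Rightarrow> real" where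
  "l2_dist M f g = sqrt (\<integral>x. (cmod (f x - g x))\<^sup>2 \<partial>M)"

type_synonym 'a op_graph = "(('a \<Rightarrow> complex) \<times> ('a \<Rightarrow> complex)) set"

definition linear_operator :: "'a measure \<Rightarrow> 'a op_graph \<Rightarrow> bool" where
  "linear_operator M T \<longleftrightarrow>
     T \<subseteq> L2 M \<times> L2 M \<and>
     ((\<lambda>x. 0), (\<lambda>x. 0)) \<in> T \<and>
     (\<forall>f g f' g'. (f, g) \<in> T \<longrightarrow> (f', g') \<in> T \<longrightarrow> ((\<lambda>x. f x + f' x), (\<lambda>x. g x + g' x)) \<in> T) \<and>
     (\<forall>a f g. (f, g) \<in> T \<longrightarrow> ((\<lambda>x. a * f x), (\<lambda>x. a * g x)) \<in> T) \<and>
     (\<forall>f g f' g'. (f, g) \<in> T \<longrightarrow> f' \<in> L2 M \<longrightarrow> g' \<in> L2 M \<longrightarrow>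
        (AE x in M. f x = f' x) \<longrightarrow> (AE x in M. g x = g' x) \<longrightarrow> (f', g') \<in> T) \<and>
     (\<forall>f g f' g'. (f, g) \<in> T \<longrightarrow> (f', g') \<in> T \<longrightarrow>
        (AE x in M. f x = f' x) \<longrightarrow> (AE x in M. g x = g' x))"

definition densely_defined :: "'a measure \<Rightarrow> 'a op_graph \<Rightarrow> bool" where
  "densely_defined M T \<longleftrightarrow> (\<forall>f\<in>L2 M. \<forall>e>0. \<exists>h\<in>Domain T. l2_dist M f h < e)"

definition adjoint_operator :: "'a measure \<Rightarrow> 'a op_graph \<Rightarrow> 'a op_graph" where
  "adjoint_operator M T =
     {(f, g). f \<in> L2 M \<and> g \<in> L2 M \<and> (\<forall>(h, k)\<in>T. l2_inner M k f = l2_inner M h g)}"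

definition closure_operator :: "'a measure \<Rightarrow> 'a op_graph \<Rightarrow> 'a op_graph" where
  "closure_operator M T =
     {(f, g). f \<in> L2 M \<and> g \<in> L2 M \<and>
        (\<exists>h k. (\<forall>n. (h n, k n) \<in> T) \<and>
           (\<lambda>n::nat. l2_dist M (h n) f) \<longlonglongrightarrow> 0 \<and> (\<lambda>n. l2_dist M (k n) g) \<longlonglongrightarrow> 0)}"

definition symmetric_operator :: "'a measure \<Rightarrow> 'a op_graph \<Rightarrow> bool" where
  "symmetric_operator M T \<longleftrightarrow>
     linear_operator M T \<and> densely_defined M T \<and>
     (\<forall>(f, g)\<in>T. \<forall>(h, k)\<in>T. l2_inner M g h = l2_inner M f k)"

definition self_adjoint_operator :: "'a measure \<Rightarrow> 'a op_graph \<Rightarrow> bool" where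
  "self_adjoint_operator M T \<longleftrightarrow>
     linear_operator M T \<and> densely_defined M T \<and> adjoint_operator M T = T"

definition essentially_self_adjoint :: "'a measure \<Rightarrow> 'a op_graph \<Rightarrow> bool" where
  "essentially_self_adjoint M T \<longleftrightarrow>
     symmetric_operator M T \<and> self_adjoint_operator M (closure_operator M T)"


section \<open>Symmetric measures and the graph Laplace operator\<close>

locale symmetric_measure_graph =
  mu: sigma_finite_measure mu + rho: sigma_finite_measure rho
  for mu :: "'v measure" and rho :: "('v \<times> 'v) measure"
    and rk :: "'v \<Rightarrow> 'v measure" and E :: "('v \<times> 'v) set" +
  assumes standard: "standard_borel_space mu"
    and nonatomic: "nonatomic mu"
    and infinite: "emeasure mu (space mu) = \<infinity>"
    and sets_rho: "sets rho = sets (mu \<Otimes>\<^sub>M mu)"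
    and rho_symmetric: "\<And>A B. A \<in> sets mu \<Longrightarrow> B \<in> sets mu \<Longrightarrow>
          emeasure rho (A \<times> B) = emeasure rho (B \<times> A)"
    and E_sets: "E \<in> sets (mu \<Otimes>\<^sub>M mu)"
    and E_symmetric: "sym E"
    and rho_support: "emeasure rho (space rho - E) = 0"
    and sets_rk: "\<And>x. x \<in> space mu \<Longrightarrow> sets (rk x) = sets mu"
    and rk_measurable: "\<And>A. A \<in> sets mu \<Longrightarrow> (\<lambda>x. emeasure (rk x) A) \<in> borel_measurable mu"
    and rk_support: "\<And>x. x \<in> space mu \<Longrightarrow> emeasure (rk x) (space mu - E `` {x}) = 0"
    and disintegration: "\<And>f :: 'v \<times> 'v \<Rightarrow> ennreal. f \<in> borel_measurable (mu \<Otimes>\<^sub>M mu) \<Longrightarrow>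
          (\<integral>\<^sup>+z. f z \<partial>rho) = (\<integral>\<^sup>+x. (\<integral>\<^sup>+y. f (x, y) \<partial>rk x) \<partial>mu)"
    and irreducible: "AE x in mu. E `` {x} \<noteq> {} \<and> uncountable (E `` {x}) \<and>
          standard_borel_space (restrict_space (rk x) (E `` {x})) \<and>
          nonatomic (restrict_space (rk x) (E `` {x}))"
    and c_pos_finite: "AE x in mu. 0 < emeasure (rk x) (space mu) \<and> emeasure (rk x) (space mu) < \<infinity>"
    and c_locally_integrable: "\<And>A. A \<in> sets mu \<Longrightarrow> emeasure mu A < \<infinity> \<Longrightarrow>
          (\<integral>\<^sup>+x\<in>A. emeasure (rk x) (space mu) \<partial>mu) < \<infinity>"

definition D_fin :: "'v measure \<Rightarrow> ('v \<Rightarrow> complex) set" where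
  "D_fin mu =
     {f. \<exists>(n::nat) a A. (\<forall>i<n. A i \<in> sets mu \<and> emeasure mu (A i) < \<infinity>) \<and>
           f = (\<lambda>x. \<Sum>i<n. a i * indicator (A i) x)}"

definition graph_laplace :: "('v \<Rightarrow> 'v measure) \<Rightarrow> ('v \<Rightarrow> complex) \<Rightarrow> 'v \<Rightarrow> complex" where
  "graph_laplace rk f x = (\<integral>y. (f x - f y) \<partial>rk x)"

text \<open>The graph of the Laplace operator with domain \<open>D_fin\<close>, in terms of representatives.\<close>

definition laplace_operator :: "'v measure \<Rightarrow> ('v \<Rightarrow> 'v measure) \<Rightarrow> 'v op_graph" where
  "laplace_operator mu rk =
     {(f, g). f \<in> L2 mu \<and> g \<in> L2 mu \<and>
        (\<exists>h\<in>D_fin mu. (AE x in mu. f x = h x) \<and> (AE x in mu. g x = graph_laplace rk h x))}"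

end

theory Submission
  imports Defs
begin

text \<open>
  Two ingredients give the result: the criterion of trivial deficiency spaces, and a rearrangement
  argument on level sets which shows that the deficiency spaces are trivial.

  A symmetric operator \<open>T\<close> is essentially self-adjoint as soon as \<open>T\<^sup>* f = \<plusminus> \<i> f\<close> has only the
  solution \<open>f = 0\<close> (\<open>essentially_self_adjoint_if_deficiency_trivial\<close>).  This rests on the
  completeness of \<open>L2\<close> (\<open>L2_complete\<close>) and on the fact that a subspace with trivial orthogonal
  complement is dense (\<open>dense_if_orthogonal_complement_trivial\<close>).

  All integrals that involve the Laplace operator are moved to the measure \<open>rho\<close> on pairs.  For
  \<open>h\<close> in \<open>D_fin\<close> and \<open>f\<close> in \<open>L2\<close>, \<open>Green_formula\<close> says
  \<open>\<langle>\<Delta> h, f\<rangle> = \<integral> (h x - h y) * cnj (f x) d rho(x, y)\<close>.  The integral converges because both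
  \<open>x \<mapsto> rk x A\<close> and, since \<open>\<Delta>\<close> maps indicators into \<open>L2\<close>, also \<open>c * indicator A\<close> with
  \<open>c x = rk x (space mu)\<close> are square-integrable for every \<open>A\<close> of finite measure.  The measure \<open>rho\<close> is invariant under
  exchanging the coordinates (\<open>distr_swap_rho\<close>), which makes \<open>\<Delta>\<close> symmetric.

  Now let \<open>T\<^sup>* f = l f\<close> with \<open>l\<close> purely imaginary and nonzero (\<open>adjoint_eigenfunction_zero\<close>).
  Fix \<open>e > 0\<close>.  The level set \<open>A = {x. e \<le> \<bar>f x\<bar>}\<close> has finite measure because \<open>f\<close> is in \<open>L2\<close>.
  Test the equation with \<open>u = indicator A * f / \<bar>f\<bar>\<close>; it reads \<open>M - w = cnj l * m\<close> with
  \<open>M = \<integral> indicator A x * \<bar>f x\<bar> d rho\<close>, \<open>w = \<integral> u y * cnj (f x) d rho\<close> and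
  \<open>m = \<integral> indicator A x * \<bar>f x\<bar> d mu\<close>.  Since \<open>indicator A\<close> is a nondecreasing function of \<open>\<bar>f\<bar>\<close>,
  \<open>(\<bar>f x\<bar> - \<bar>f y\<bar>) * (indicator A x - indicator A y) \<ge> 0\<close>, and integrating this against the
  symmetric \<open>rho\<close> gives \<open>\<integral> indicator A y * \<bar>f x\<bar> d rho \<le> M\<close>
  (\<open>integral_level_set_swap_le\<close>), hence \<open>\<bar>w\<bar> \<le> M\<close>.  But \<open>\<bar>w\<bar>\<^sup>2 = M\<^sup>2 + \<bar>l\<bar>\<^sup>2 * m\<^sup>2\<close>, so \<open>m = 0\<close> and \<open>A\<close>
  is a null set.  As \<open>e\<close> was arbitrary, \<open>f = 0\<close>.
\<close>

section \<open>Square-integrable functions\<close>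

lemma borel_measurable_cnj [measurable (raw)]:
  "f \<in> borel_measurable M \<Longrightarrow> (\<lambda>x. cnj (f x)) \<in> borel_measurable M"
  by (rule measurable_compose[OF _ borel_measurable_continuous_onI]) (auto intro!: continuous_intros)

definition l2_norm :: "'a measure \<Rightarrow> ('a \<Rightarrow> complex) \<Rightarrow> real" where
  "l2_norm M f = sqrt (\<integral>x. (cmod (f x))\<^sup>2 \<partial>M)"

lemma l2_dist_eq_norm: "l2_dist M f g = l2_norm M (\<lambda>x. f x - g x)"
  by (simp add: l2_dist_def l2_norm_def)

lemma l2_norm_nonneg [simp]: "0 \<le> l2_norm M f"
  by (simp add: l2_norm_def)

lemma l2_norm_sq: "(l2_norm M f)\<^sup>2 = (\<integral>x. (cmod (f x))\<^sup>2 \<partial>M)"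
  by (simp add: l2_norm_def)

lemma L2_measurable [measurable_dest]: "f \<in> L2 M \<Longrightarrow> f \<in> borel_measurable M"
  by (simp add: L2_def)

lemma L2_integrable: "f \<in> L2 M \<Longrightarrow> integrable M (\<lambda>x. (cmod (f x))\<^sup>2)"
  by (simp add: L2_def)

lemma L2_zero [simp]: "(\<lambda>x. 0) \<in> L2 M"
  by (simp add: L2_def)

lemma L2_dominated:
  assumes "f \<in> L2 M" "g \<in> borel_measurable M" "AE x in M. cmod (g x) \<le> a * cmod (f x)"
  shows "g \<in> L2 M"
proof -
  have [measurable]: "g \<in> borel_measurable M" by fact
  have "integrable M (\<lambda>x. (cmod (g x))\<^sup>2)"
  proof (rule Bochner_Integration.integrable_bound)
    show "integrable M (\<lambda>x. a\<^sup>2 * (cmod (f x))\<^sup>2)"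
      using L2_integrable[OF assms(1)] by simp
    show "AE x in M. norm ((cmod (g x))\<^sup>2) \<le> norm (a\<^sup>2 * (cmod (f x))\<^sup>2)"
      using assms(3)
    proof eventually_elim
      case (elim x)
      show ?case using power_mono[OF elim, of 2] by (simp add: power_mult_distrib)
    qed
  qed simp
  then show ?thesis using assms(2) by (simp add: L2_def)
qed

lemma L2_cong_AE:
  assumes "f \<in> L2 M" "g \<in> borel_measurable M" "AE x in M. f x = g x"
  shows "g \<in> L2 M"
proof (rule L2_dominated[OF assms(1,2), of 1])
  show "AE x in M. cmod (g x) \<le> 1 * cmod (f x)" using assms(3) by eventually_elim simp
qed

lemma L2_scale: "f \<in> L2 M \<Longrightarrow> (\<lambda>x. a * f x) \<in> L2 M"
  by (rule L2_dominated[of f _ _ "cmod a"]) (auto simp: norm_mult L2_def)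

lemma L2_add:
  assumes f: "f \<in> L2 M" and g: "g \<in> L2 M"
  shows "(\<lambda>x. f x + g x) \<in> L2 M"
proof -
  have [measurable]: "f \<in> borel_measurable M" "g \<in> borel_measurable M" using f g by (auto simp: L2_def)
  have "integrable M (\<lambda>x. (cmod (f x + g x))\<^sup>2)"
  proof (rule Bochner_Integration.integrable_bound)
    show "integrable M (\<lambda>x. 2 * (cmod (f x))\<^sup>2 + 2 * (cmod (g x))\<^sup>2)"
      using L2_integrable[OF f] L2_integrable[OF g] by simp
    have "(cmod (f x + g x))\<^sup>2 \<le> 2 * (cmod (f x))\<^sup>2 + 2 * (cmod (g x))\<^sup>2" for x
    proof -
      have "(cmod (f x + g x))\<^sup>2 \<le> (cmod (f x) + cmod (g x))\<^sup>2"
        by (intro power_mono norm_triangle_ineq) simp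
      also have "\<dots> \<le> 2 * (cmod (f x))\<^sup>2 + 2 * (cmod (g x))\<^sup>2"
        using sum_squares_bound[of "cmod (f x)" "cmod (g x)"] by (simp add: power2_sum)
      finally show ?thesis .
    qed
    then show "AE x in M. norm ((cmod (f x + g x))\<^sup>2) \<le> norm (2 * (cmod (f x))\<^sup>2 + 2 * (cmod (g x))\<^sup>2)"
      by simp
  qed simp
  then show ?thesis by (simp add: L2_def)
qed

lemma L2_diff: "f \<in> L2 M \<Longrightarrow> g \<in> L2 M \<Longrightarrow> (\<lambda>x. f x - g x) \<in> L2 M"
  using L2_add[of f M "\<lambda>x. -1 * g x"] L2_scale[of g M "-1"] by simp

lemma L2_integrable_mult:
  assumes f: "f \<in> L2 M" and g: "g \<in> L2 M"
  shows "integrable M (\<lambda>x. f x * cnj (g x))"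
proof (rule Bochner_Integration.integrable_bound)
  show "integrable M (\<lambda>x. (cmod (f x))\<^sup>2 + (cmod (g x))\<^sup>2)"
    using L2_integrable[OF f] L2_integrable[OF g] by simp
  show "(\<lambda>x. f x * cnj (g x)) \<in> borel_measurable M" using f g by (auto simp: L2_def)
  have "cmod (f x) * cmod (g x) \<le> (cmod (f x))\<^sup>2 + (cmod (g x))\<^sup>2" for x
    using sum_squares_bound[of "cmod (f x)" "cmod (g x)"]
      mult_nonneg_nonneg[OF norm_ge_zero[of "f x"] norm_ge_zero[of "g x"]] by linarith
  then show "AE x in M. norm (f x * cnj (g x)) \<le> norm ((cmod (f x))\<^sup>2 + (cmod (g x))\<^sup>2)"
    by (simp add: norm_mult)
qed

lemma l2_inner_add_left:
  "f \<in> L2 M \<Longrightarrow> g \<in> L2 M \<Longrightarrow> h \<in> L2 M \<Longrightarrow>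
    l2_inner M (\<lambda>x. f x + g x) h = l2_inner M f h + l2_inner M g h"
  unfolding l2_inner_def by (simp add: distrib_right L2_integrable_mult)

lemma l2_inner_diff_left:
  "f \<in> L2 M \<Longrightarrow> g \<in> L2 M \<Longrightarrow> h \<in> L2 M \<Longrightarrow>
    l2_inner M (\<lambda>x. f x - g x) h = l2_inner M f h - l2_inner M g h"
  unfolding l2_inner_def by (simp add: left_diff_distrib L2_integrable_mult)

lemma l2_inner_scale_left: "l2_inner M (\<lambda>x. a * f x) h = a * l2_inner M f h"
  unfolding l2_inner_def by (simp add: mult.assoc)

lemma l2_inner_commute: "l2_inner M g f = cnj (l2_inner M f g)"
proof -
  have "cnj (l2_inner M f g) = (\<integral>x. cnj (f x * cnj (g x)) \<partial>M)"
    unfolding l2_inner_def by (rule Bochner_Integration.integral_cnj[symmetric])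
  then show ?thesis by (simp add: l2_inner_def mult.commute)
qed

lemma l2_inner_add_right:
  "f \<in> L2 M \<Longrightarrow> g \<in> L2 M \<Longrightarrow> h \<in> L2 M \<Longrightarrow>
    l2_inner M h (\<lambda>x. f x + g x) = l2_inner M h f + l2_inner M h g"
  by (simp add: l2_inner_commute[of M h] l2_inner_add_left)

lemma l2_inner_diff_right:
  "f \<in> L2 M \<Longrightarrow> g \<in> L2 M \<Longrightarrow> h \<in> L2 M \<Longrightarrow>
    l2_inner M h (\<lambda>x. f x - g x) = l2_inner M h f - l2_inner M h g"
  by (simp add: l2_inner_commute[of M h] l2_inner_diff_left)

lemma l2_inner_scale_right: "l2_inner M h (\<lambda>x. a * f x) = cnj a * l2_inner M h f"
  by (simp add: l2_inner_commute[of M h] l2_inner_scale_left)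

lemma l2_inner_zero_right [simp]: "l2_inner M f (\<lambda>x. 0) = 0"
  and l2_inner_zero_left [simp]: "l2_inner M (\<lambda>x. 0) f = 0"
  by (simp_all add: l2_inner_def)

lemma l2_inner_self: "l2_inner M f f = complex_of_real ((l2_norm M f)\<^sup>2)"
  unfolding l2_inner_def l2_norm_sq by (simp add: complex_norm_square[symmetric] flip: of_real_power)

lemma l2_inner_cong_AE:
  assumes "f \<in> borel_measurable M" "f' \<in> borel_measurable M" "g \<in> borel_measurable M"
    "g' \<in> borel_measurable M" "AE x in M. f x = f' x" "AE x in M. g x = g' x"
  shows "l2_inner M f g = l2_inner M f' g'"
  unfolding l2_inner_def using assms(5,6) by (intro integral_cong_AE) (use assms in auto)

lemma l2_norm_scale: "l2_norm M (\<lambda>x. a * f x) = cmod a * l2_norm M f"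
  by (simp add: l2_norm_def norm_mult power_mult_distrib real_sqrt_mult)

lemma l2_norm_eq_0_AE:
  assumes f: "f \<in> L2 M" and "l2_norm M f = 0"
  shows "AE x in M. f x = 0"
proof -
  have "(\<integral>x. (cmod (f x))\<^sup>2 \<partial>M) = 0" using assms(2) by (simp add: l2_norm_def)
  then show ?thesis
    using integral_nonneg_eq_0_iff_AE[OF L2_integrable[OF f]] by simp
qed

lemma l2_norm_add_sq:
  assumes f: "f \<in> L2 M" and g: "g \<in> L2 M"
  shows "(l2_norm M (\<lambda>x. f x + g x))\<^sup>2 = (l2_norm M f)\<^sup>2 + 2 * Re (l2_inner M f g) + (l2_norm M g)\<^sup>2"
proof -
  have fg: "(\<lambda>x. f x + g x) \<in> L2 M" using f g by (rule L2_add)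
  have "complex_of_real ((l2_norm M (\<lambda>x. f x + g x))\<^sup>2)
    = l2_inner M f f + l2_inner M f g + (cnj (l2_inner M f g) + l2_inner M g g)"
    by (simp only: l2_inner_self[symmetric] l2_inner_add_left[OF f g fg] l2_inner_add_right[OF f g f]
          l2_inner_add_right[OF f g g] l2_inner_commute[of M g f])
  from arg_cong[OF this, of Re] show ?thesis by (simp add: l2_inner_self)
qed

lemma l2_Cauchy_Schwarz:
  assumes f: "f \<in> L2 M" and g: "g \<in> L2 M"
  shows "cmod (l2_inner M f g) \<le> l2_norm M f * l2_norm M g"
proof -
  have [measurable]: "f \<in> borel_measurable M" "g \<in> borel_measurable M" using f g by (auto simp: L2_def)
  have i: "integrable M (\<lambda>x. cmod (f x) * cmod (g x))"
    using integrable_norm[OF L2_integrable_mult[OF f g]] by (simp add: norm_mult)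
  have *: "(\<integral>x. cmod (f x) * cmod (g x) \<partial>M)\<^sup>2 \<le> (l2_norm M f)\<^sup>2 * (l2_norm M g)\<^sup>2"
  proof -
    have "(\<integral>\<^sup>+x. ennreal (cmod (f x)) * ennreal (cmod (g x)) \<partial>M)\<^sup>2
      \<le> (\<integral>\<^sup>+x. (ennreal (cmod (f x)))\<^sup>2 \<partial>M) * (\<integral>\<^sup>+x. (ennreal (cmod (g x)))\<^sup>2 \<partial>M)"
      by (rule Cauchy_Schwarz_nn_integral) auto
    moreover have "(\<integral>\<^sup>+x. (ennreal (cmod (h x)))\<^sup>2 \<partial>M) = ennreal ((l2_norm M h)\<^sup>2)" if "h \<in> L2 M" for h
    proof -
      have "(\<integral>\<^sup>+x. (ennreal (cmod (h x)))\<^sup>2 \<partial>M) = (\<integral>\<^sup>+x. ennreal ((cmod (h x))\<^sup>2) \<partial>M)"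
        by (simp add: ennreal_power)
      then show ?thesis using nn_integral_eq_integral[OF L2_integrable[OF that]] by (simp add: l2_norm_sq)
    qed
    moreover have "(\<integral>\<^sup>+x. ennreal (cmod (f x)) * ennreal (cmod (g x)) \<partial>M) = ennreal (\<integral>x. cmod (f x) * cmod (g x) \<partial>M)"
      using nn_integral_eq_integral[OF i] by (simp add: ennreal_mult)
    ultimately have "ennreal ((\<integral>x. cmod (f x) * cmod (g x) \<partial>M)\<^sup>2) \<le> ennreal ((l2_norm M f)\<^sup>2) * ennreal ((l2_norm M g)\<^sup>2)"
      using f g by (simp add: ennreal_power)
    then have "ennreal ((\<integral>x. cmod (f x) * cmod (g x) \<partial>M)\<^sup>2) \<le> ennreal ((l2_norm M f)\<^sup>2 * (l2_norm M g)\<^sup>2)"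
      by (simp only: ennreal_mult zero_le_power2)
    then show ?thesis by (subst (asm) ennreal_le_iff) auto
  qed
  have "cmod (l2_inner M f g) \<le> (\<integral>x. cmod (f x) * cmod (g x) \<partial>M)"
    unfolding l2_inner_def using integral_norm_bound[of M "\<lambda>x. f x * cnj (g x)"] by (simp add: norm_mult)
  also have "\<dots> \<le> l2_norm M f * l2_norm M g"
    by (rule power2_le_imp_le) (use * in \<open>simp_all add: power_mult_distrib\<close>)
  finally show ?thesis .
qed

lemma l2_norm_triangle:
  assumes f: "f \<in> L2 M" and g: "g \<in> L2 M"
  shows "l2_norm M (\<lambda>x. f x + g x) \<le> l2_norm M f + l2_norm M g"
proof (rule power2_le_imp_le)
  have "Re (l2_inner M f g) \<le> l2_norm M f * l2_norm M g"
    using l2_Cauchy_Schwarz[OF f g] complex_Re_le_cmod order_trans by blast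
  then show "(l2_norm M (\<lambda>x. f x + g x))\<^sup>2 \<le> (l2_norm M f + l2_norm M g)\<^sup>2"
    by (simp add: l2_norm_add_sq[OF f g] power2_sum)
qed simp

lemma l2_dist_commute: "l2_dist M f g = l2_dist M g f"
  by (simp add: l2_dist_def norm_minus_commute)

lemma l2_dist_triangle:
  assumes "f \<in> L2 M" "g \<in> L2 M" "h \<in> L2 M"
  shows "l2_dist M f h \<le> l2_dist M f g + l2_dist M g h"
  using l2_norm_triangle[of "\<lambda>x. f x - g x" M "\<lambda>x. g x - h x"] assms
  by (simp add: l2_dist_eq_norm L2_diff)

lemma l2_dist_nonneg [simp]: "0 \<le> l2_dist M f g"
  by (simp add: l2_dist_eq_norm)

lemma l2_inner_tendsto_left:
  assumes "\<And>n. h n \<in> L2 M" "f \<in> L2 M" "g \<in> L2 M" and lim: "(\<lambda>n::nat. l2_dist M (h n) f) \<longlonglongrightarrow> 0"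
  shows "(\<lambda>n. l2_inner M (h n) g) \<longlonglongrightarrow> l2_inner M f g"
proof -
  have "(\<lambda>n. l2_inner M (h n) g - l2_inner M f g) \<longlonglongrightarrow> 0"
  proof (rule Lim_null_comparison)
    show "(\<lambda>n. l2_dist M (h n) f * l2_norm M g) \<longlonglongrightarrow> 0"
      using tendsto_mult_left_zero[OF lim] .
    show "\<forall>\<^sub>F n in sequentially. norm (l2_inner M (h n) g - l2_inner M f g) \<le> l2_dist M (h n) f * l2_norm M g"
      using l2_Cauchy_Schwarz[OF L2_diff[OF assms(1,2)] assms(3)] assms(1-3)
      by (simp add: l2_inner_diff_left l2_dist_eq_norm)
  qed
  then show ?thesis using Lim_null by blast
qed

lemma l2_norm_tendsto:
  assumes h: "\<And>n. h n \<in> L2 M" and f: "f \<in> L2 M" and lim: "(\<lambda>n::nat. l2_dist M (h n) f) \<longlonglongrightarrow> 0"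
  shows "(\<lambda>n. l2_norm M (h n)) \<longlonglongrightarrow> l2_norm M f"
proof -
  have "\<bar>l2_norm M (h n) - l2_norm M f\<bar> \<le> l2_dist M (h n) f" for n
    using l2_dist_triangle[OF h f L2_zero, of n] l2_dist_triangle[OF f h L2_zero, of n]
    by (simp add: l2_dist_eq_norm[of _ _ "\<lambda>x. 0"] l2_dist_commute[of M f])
  then have "(\<lambda>n. l2_norm M (h n) - l2_norm M f) \<longlonglongrightarrow> 0"
    by (intro Lim_null_comparison[OF _ lim]) simp
  then show ?thesis using Lim_null by blast
qed

section \<open>Completeness\<close>

lemma l2_dist_nn_integral:
  assumes "f \<in> L2 M" "g \<in> L2 M"
  shows "(\<integral>\<^sup>+x. ennreal ((cmod (f x - g x))\<^sup>2) \<partial>M) = ennreal ((l2_dist M f g)\<^sup>2)"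
  using L2_integrable[OF L2_diff[OF assms]]
  by (simp add: nn_integral_eq_integral l2_dist_eq_norm l2_norm_sq)

text \<open>
  The series of \<open>2 ^ k * \<bar>u k - u (k + 1)\<bar>\<^sup>2\<close> has finite integral, hence finite sum almost everywhere.
  The weight \<open>2 ^ k\<close> makes this strong enough to sum the distances \<open>\<bar>u k x - u (k + 1) x\<bar>\<close> themselves,
  so no triangle inequality for infinite sums in \<open>L2\<close> is involved.
\<close>

lemma fast_Cauchy_imp_AE_convergent:
  assumes u: "\<And>k. u k \<in> L2 M" and fast: "\<And>k. l2_dist M (u k) (u (Suc k)) \<le> (1/2)^k"
  shows "AE x in M. convergent (\<lambda>k. u k x)"
proof -
  have [measurable]: "u k \<in> borel_measurable M" for k using u by (auto simp: L2_def)
  let ?w = "\<lambda>k x. 2^k * (cmod (u k x - u (Suc k) x))\<^sup>2"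
  have "(\<integral>\<^sup>+x. (\<Sum>k. ennreal (?w k x)) \<partial>M) = (\<Sum>k. \<integral>\<^sup>+x. ennreal (?w k x) \<partial>M)"
    by (intro nn_integral_suminf) simp
  also have "\<dots> = (\<Sum>k. ennreal (2^k * (l2_dist M (u k) (u (Suc k)))\<^sup>2))"
  proof (rule suminf_cong)
    fix k
    have "(\<integral>\<^sup>+x. ennreal (?w k x) \<partial>M) = (\<integral>\<^sup>+x. ennreal (2^k) * ennreal ((cmod (u k x - u (Suc k) x))\<^sup>2) \<partial>M)"
      by (intro nn_integral_cong ennreal_mult) simp_all
    also have "\<dots> = ennreal (2^k) * ennreal ((l2_dist M (u k) (u (Suc k)))\<^sup>2)"
      by (subst nn_integral_cmult) (simp, simp only: l2_dist_nn_integral u)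
    also have "\<dots> = ennreal (2^k * (l2_dist M (u k) (u (Suc k)))\<^sup>2)"
      by (rule ennreal_mult[symmetric]) simp_all
    finally show "(\<integral>\<^sup>+x. ennreal (?w k x) \<partial>M) = ennreal (2^k * (l2_dist M (u k) (u (Suc k)))\<^sup>2)" .
  qed
  also have "\<dots> \<le> (\<Sum>k. ennreal ((1/2)^k))"
  proof (rule suminf_le)
    fix k
    have "2^k * (l2_dist M (u k) (u (Suc k)))\<^sup>2 \<le> 2^k * ((1/2)^k)\<^sup>2"
      by (intro mult_left_mono power_mono fast) simp_all
    also have "\<dots> = (1/2::real)^k"
      by (simp add: power2_eq_square power_one_over)
    finally show "ennreal (2^k * (l2_dist M (u k) (u (Suc k)))\<^sup>2) \<le> ennreal ((1/2)^k)"
      by (rule ennreal_leI)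
  qed auto
  also have "\<dots> < \<infinity>"
    by (subst suminf_ennreal2) (auto intro: summable_geometric)
  finally have "AE x in M. (\<Sum>k. ennreal (?w k x)) \<noteq> \<infinity>"
    by (intro nn_integral_noteq_infinite) auto
  then show ?thesis
  proof eventually_elim
    case (elim x)
    have "summable (\<lambda>k. ?w k x)"
    proof (rule summable_suminf_not_top)
      show "(\<Sum>k. ennreal (?w k x)) \<noteq> top" using elim unfolding infinity_ennreal_def .
    qed simp
    then have s: "summable (\<lambda>k. (1/2)^k + ?w k x)"
      by (intro summable_add) (auto intro: summable_geometric)
    have "summable (\<lambda>k. u (Suc k) x - u k x)"
    proof (rule summable_comparison_test'[OF s])
      fix k
      let ?d = "cmod (u k x - u (Suc k) x)"
      \<comment> \<open>the inequality of arithmetic and geometric means with weight 2 ^ k\<close>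
      have "0 \<le> (1/2)^k * (1 - 2^k * ?d)\<^sup>2" by simp
      also have "\<dots> = (1/2)^k + ?w k x - 2 * ?d"
        by (simp add: power2_eq_square algebra_simps power_one_over)
      finally have "2 * ?d \<le> (1/2)^k + ?w k x" by simp
      moreover have "0 \<le> ?d" by simp
      ultimately have "?d \<le> (1/2)^k + ?w k x" by linarith
      then show "norm (u (Suc k) x - u k x) \<le> (1/2)^k + ?w k x"
        by (simp add: norm_minus_commute)
    qed
    then have "convergent (\<lambda>n. \<Sum>k<n. u (Suc k) x - u k x)"
      by (simp add: summable_iff_convergent)
    then have "convergent (\<lambda>n. u n x - u 0 x)"
      using sum_lessThan_telescope[of "\<lambda>k. u k x"] by simp
    then have "convergent (\<lambda>n. (u n x - u 0 x) + u 0 x)"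
      by (intro convergent_add convergent_const)
    then show ?case by (simp only: diff_add_cancel)
  qed
qed

text \<open>
  The limit is the pointwise limit of a rapidly convergent subsequence; Fatou's lemma turns the
  pointwise convergence into convergence of the distances.
\<close>

theorem L2_complete:
  assumes f: "\<And>n. f n \<in> L2 M"
    and Cauchy: "\<And>e. 0 < e \<Longrightarrow> \<exists>N. \<forall>m\<ge>N. \<forall>n\<ge>N. l2_dist M (f m) (f n) < e"
  shows "\<exists>g\<in>L2 M. (\<lambda>n::nat. l2_dist M (f n) g) \<longlonglongrightarrow> 0"
proof -
  have [measurable]: "f k \<in> borel_measurable M" for k using f by (auto simp: L2_def)
  have "\<exists>N. \<forall>k. \<forall>m\<ge>N k. \<forall>n\<ge>N k. l2_dist M (f m) (f n) < (1/2)^k"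
    using Cauchy by (intro choice) auto
  then obtain N where N: "\<And>k m n. m \<ge> N k \<Longrightarrow> n \<ge> N k \<Longrightarrow> l2_dist M (f m) (f n) < (1/2)^k" by metis
  define r where "r k = k + (\<Sum>i\<le>k. N i)" for k
  have r: "N k \<le> r k" "N k \<le> r (Suc k)" "k \<le> r k" for k
  proof -
    have "N k \<le> (\<Sum>i\<le>k. N i)" "N k \<le> (\<Sum>i\<le>Suc k. N i)"
      by (auto intro!: member_le_sum simp del: sum.atMost_Suc)
    then show "N k \<le> r k" "N k \<le> r (Suc k)" "k \<le> r k" by (simp_all add: r_def)
  qed
  have conv: "AE x in M. convergent (\<lambda>k. f (r k) x)"
    by (rule fast_Cauchy_imp_AE_convergent) (auto intro!: f less_imp_le N r)
  define g where "g x = lim (\<lambda>k. f (r k) x)" for x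
  have [measurable]: "g \<in> borel_measurable M" unfolding g_def by measurable
  have lim: "AE x in M. (\<lambda>k. f (r k) x) \<longlonglongrightarrow> g x"
    using conv by eventually_elim (simp add: g_def convergent_LIMSEQ_iff)
  have bound: "(\<integral>\<^sup>+x. ennreal ((cmod (f n x - g x))\<^sup>2) \<partial>M) \<le> ennreal (e\<^sup>2)"
    if e: "0 < e" and n: "\<And>m. n0 \<le> m \<Longrightarrow> l2_dist M (f n) (f m) \<le> e" for e n n0
  proof -
    have "(\<integral>\<^sup>+x. ennreal ((cmod (f n x - g x))\<^sup>2) \<partial>M)
      = (\<integral>\<^sup>+x. liminf (\<lambda>k. ennreal ((cmod (f n x - f (r k) x))\<^sup>2)) \<partial>M)"
    proof (rule nn_integral_cong_AE)
      show "AE x in M. ennreal ((cmod (f n x - g x))\<^sup>2) = liminf (\<lambda>k. ennreal ((cmod (f n x - f (r k) x))\<^sup>2))"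
        using lim
      proof eventually_elim
        case (elim x)
        have "(\<lambda>k. ennreal ((cmod (f n x - f (r k) x))\<^sup>2)) \<longlonglongrightarrow> ennreal ((cmod (f n x - g x))\<^sup>2)"
          by (rule tendsto_ennrealI[OF tendsto_power[OF tendsto_norm[OF tendsto_diff[OF tendsto_const elim]]]])
        from lim_imp_Liminf[OF sequentially_bot this] show ?case by (rule sym)
      qed
    qed
    also have "\<dots> \<le> liminf (\<lambda>k. \<integral>\<^sup>+x. ennreal ((cmod (f n x - f (r k) x))\<^sup>2) \<partial>M)"
      by (rule nn_integral_liminf) simp
    also have "\<dots> = liminf (\<lambda>k. ennreal ((l2_dist M (f n) (f (r k)))\<^sup>2))"
      by (simp add: l2_dist_nn_integral f)
    also have "\<dots> \<le> limsup (\<lambda>k. ennreal ((l2_dist M (f n) (f (r k)))\<^sup>2))"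
      by (rule Liminf_le_Limsup) simp
    also have "\<dots> \<le> ennreal (e\<^sup>2)"
    proof (rule Limsup_bounded)
      show "\<forall>\<^sub>F k in sequentially. ennreal ((l2_dist M (f n) (f (r k)))\<^sup>2) \<le> ennreal (e\<^sup>2)"
        using eventually_ge_at_top[of n0]
      proof eventually_elim
        case (elim k)
        then have "n0 \<le> r k" using r(3)[of k] by linarith
        then show ?case using n by (intro ennreal_leI power_mono) auto
      qed
    qed
    finally show ?thesis .
  qed
  have dist_bound: "(\<lambda>x. f n x - g x) \<in> L2 M \<and> l2_dist M (f n) g \<le> e"
    if e: "0 < e" and n: "\<And>m. n0 \<le> m \<Longrightarrow> l2_dist M (f n) (f m) \<le> e" for e n n0
  proof -
    have i: "integrable M (\<lambda>x. (cmod (f n x - g x))\<^sup>2)"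
      using order.strict_trans1[OF bound[OF e n]] by (intro integrableI_bounded) auto
    then have "ennreal ((l2_dist M (f n) g)\<^sup>2) \<le> ennreal (e\<^sup>2)"
      using bound[OF e n] by (simp add: nn_integral_eq_integral l2_dist_def)
    then have "(l2_dist M (f n) g)\<^sup>2 \<le> e\<^sup>2" by (subst (asm) ennreal_le_iff) auto
    then show ?thesis using i e by (auto simp: L2_def intro: power2_le_imp_le)
  qed
  have "g \<in> L2 M"
  proof -
    obtain n0 where "\<And>m n. n0 \<le> m \<Longrightarrow> n0 \<le> n \<Longrightarrow> l2_dist M (f m) (f n) < 1" using Cauchy[of 1] by auto
    then have "(\<lambda>x. f n0 x - g x) \<in> L2 M" using dist_bound[of 1 n0 n0] by (auto simp: less_imp_le)
    then show ?thesis using L2_diff[OF f[of n0]] by fastforce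
  qed
  moreover have "(\<lambda>n. l2_dist M (f n) g) \<longlonglongrightarrow> 0"
  proof (rule LIMSEQ_I)
    fix e :: real assume e: "0 < e"
    obtain n0 where n0: "\<And>m n. n0 \<le> m \<Longrightarrow> n0 \<le> n \<Longrightarrow> l2_dist M (f m) (f n) < e/2"
      using Cauchy[of "e/2"] e by auto
    have "l2_dist M (f n) g \<le> e/2" if "n0 \<le> n" for n
      using dist_bound[of "e/2" n0 n] e n0[OF that] by (auto simp: less_imp_le)
    then show "\<exists>no. \<forall>n\<ge>no. norm (l2_dist M (f n) g - 0) < e" using e by force
  qed
  ultimately show ?thesis by blast
qed

section \<open>Density by orthogonality\<close>

lemma l2_parallelogram:
  assumes f: "f \<in> L2 M" and g: "g \<in> L2 M"
  shows "(l2_norm M (\<lambda>x. f x + g x))\<^sup>2 + (l2_norm M (\<lambda>x. f x - g x))\<^sup>2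
    = 2 * (l2_norm M f)\<^sup>2 + 2 * (l2_norm M g)\<^sup>2"
  using l2_norm_add_sq[OF f g] l2_norm_add_sq[OF f L2_scale[OF g, of "-1"]]
    l2_norm_scale[of M "-1" g] l2_inner_scale_right[of M f "-1" g] by simp

text \<open>
  This is the projection theorem in disguise: by the parallelogram law a sequence in \<open>S\<close> that minimises
  the distance to \<open>h\<close> is a Cauchy sequence, and for its limit \<open>r\<close> the vector \<open>r - h\<close> is orthogonal
  to \<open>S\<close>.
\<close>

theorem dense_if_orthogonal_complement_trivial:
  assumes S: "S \<subseteq> L2 M" "S \<noteq> {}"
    and lin: "\<And>f g a. f \<in> S \<Longrightarrow> g \<in> S \<Longrightarrow> (\<lambda>x. f x + a * g x) \<in> S"
    and triv: "\<And>f. f \<in> L2 M \<Longrightarrow> (\<And>s. s \<in> S \<Longrightarrow> l2_inner M s f = 0) \<Longrightarrow> AE x in M. f x = 0"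
    and h: "h \<in> L2 M"
  shows "\<exists>s. (\<forall>n. s n \<in> S) \<and> (\<lambda>n::nat. l2_dist M (s n) h) \<longlonglongrightarrow> 0"
proof -
  have S2: "s \<in> S \<Longrightarrow> s \<in> L2 M" for s using S(1) by auto
  have zero: "(\<lambda>x. 0) \<in> S" using S(2) lin[of _ _ "-1"] by fastforce
  have scale: "f \<in> S \<Longrightarrow> (\<lambda>x. a * f x) \<in> S" for f a using lin[OF zero, of f a] by simp
  define d where "d = (INF s\<in>S. (l2_dist M s h)\<^sup>2)"
  have bdd: "bdd_below ((\<lambda>s. (l2_dist M s h)\<^sup>2) ` S)" by (rule bdd_belowI[of _ 0]) auto
  have d_le: "d \<le> (l2_dist M s h)\<^sup>2" if "s \<in> S" for s
    unfolding d_def by (rule cINF_lower[OF bdd that])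
  have "\<exists>s\<in>S. (l2_dist M s h)\<^sup>2 < d + 1 / real (Suc n)" for n
    using cINF_less_iff[OF S(2) bdd, of "d + 1 / real (Suc n)"] by (simp add: d_def)
  then obtain s where s: "\<And>n. s n \<in> S" and s_less: "\<And>n. (l2_dist M (s n) h)\<^sup>2 < d + 1 / real (Suc n)"
    by metis
  have sL2: "s n \<in> L2 M" for n by (rule S2[OF s])
  have close: "(l2_dist M (s m) (s n))\<^sup>2 \<le> 2 / real (Suc m) + 2 / real (Suc n)" for m n
  proof -
    let ?mid = "\<lambda>x. 1/2 * (s m x + 1 * s n x)"
    have eq: "(\<lambda>x. (s m x - h x) + (s n x - h x)) = (\<lambda>x. 2 * (?mid x - h x))"
      by (simp add: fun_eq_iff algebra_simps)
    have "(l2_norm M (\<lambda>x. (s m x - h x) + (s n x - h x)))\<^sup>2 + (l2_norm M (\<lambda>x. (s m x - h x) - (s n x - h x)))\<^sup>2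
       = 2 * (l2_norm M (\<lambda>x. s m x - h x))\<^sup>2 + 2 * (l2_norm M (\<lambda>x. s n x - h x))\<^sup>2"
      by (intro l2_parallelogram L2_diff sL2 h)
    then have "4 * (l2_dist M ?mid h)\<^sup>2 + (l2_dist M (s m) (s n))\<^sup>2
       = 2 * (l2_dist M (s m) h)\<^sup>2 + 2 * (l2_dist M (s n) h)\<^sup>2"
      unfolding eq by (simp only: l2_norm_scale l2_dist_eq_norm power_mult_distrib) simp
    moreover have "d \<le> (l2_dist M ?mid h)\<^sup>2" by (intro d_le scale lin s)
    ultimately show ?thesis using s_less[of m] s_less[of n] by simp
  qed
  have "\<exists>r\<in>L2 M. (\<lambda>n. l2_dist M (s n) r) \<longlonglongrightarrow> 0"
  proof (rule L2_complete)
    fix e :: real assume e: "0 < e"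
    then obtain N where N: "1 / real (Suc N) < e\<^sup>2 / 4"
      using nat_approx_posE[of "e\<^sup>2 / 4"] by auto
    have "l2_dist M (s m) (s n) < e" if "N \<le> m" "N \<le> n" for m n
    proof (rule power2_less_imp_less)
      have *: "1 / real (Suc m) \<le> 1 / real (Suc N)" "1 / real (Suc n) \<le> 1 / real (Suc N)"
        using that by (auto intro!: divide_left_mono)
      show "(l2_dist M (s m) (s n))\<^sup>2 < e\<^sup>2" using close[of m n] N * by simp
    qed (use e in simp)
    then show "\<exists>N. \<forall>m\<ge>N. \<forall>n\<ge>N. l2_dist M (s m) (s n) < e" by blast
  qed (rule sL2)
  then obtain r where r: "r \<in> L2 M" and r_lim: "(\<lambda>n. l2_dist M (s n) r) \<longlonglongrightarrow> 0" by blast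
  define w where "w x = r x - h x" for x
  have w: "w \<in> L2 M" unfolding w_def using r h by (rule L2_diff)
  have lim: "(\<lambda>n. (l2_dist M (\<lambda>x. s n x + t x) h)\<^sup>2) \<longlonglongrightarrow> (l2_norm M (\<lambda>x. w x + t x))\<^sup>2"
    if t: "t \<in> L2 M" for t
  proof (rule tendsto_power)
    have "(\<lambda>n. l2_norm M (\<lambda>x. s n x + t x - h x)) \<longlonglongrightarrow> l2_norm M (\<lambda>x. w x + t x)"
    proof (rule l2_norm_tendsto)
      have "(\<lambda>n. l2_dist M (\<lambda>x. s n x + t x - h x) (\<lambda>x. w x + t x)) = (\<lambda>n. l2_dist M (s n) r)"
        by (simp add: l2_dist_def w_def)
      then show "(\<lambda>n. l2_dist M (\<lambda>x. s n x + t x - h x) (\<lambda>x. w x + t x)) \<longlonglongrightarrow> 0"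
        using r_lim by simp
    qed (intro L2_diff L2_add sL2 t h w)+
    then show "(\<lambda>n. l2_dist M (\<lambda>x. s n x + t x) h) \<longlonglongrightarrow> l2_norm M (\<lambda>x. w x + t x)"
      by (simp add: l2_dist_eq_norm)
  qed
  have w_le: "(l2_norm M w)\<^sup>2 \<le> d"
  proof (rule LIMSEQ_le)
    show "(\<lambda>n. (l2_dist M (s n) h)\<^sup>2) \<longlonglongrightarrow> (l2_norm M w)\<^sup>2" using lim[OF L2_zero] by simp
    show "(\<lambda>n. d + 1 / real (Suc n)) \<longlonglongrightarrow> d"
      using LIMSEQ_inverse_real_of_nat_add[of d] by (simp add: inverse_eq_divide)
    show "\<exists>N. \<forall>n\<ge>N. (l2_dist M (s n) h)\<^sup>2 \<le> d + 1 / real (Suc n)"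
      using s_less by (auto intro: less_imp_le)
  qed
  have min: "(l2_norm M w)\<^sup>2 \<le> (l2_norm M (\<lambda>x. w x + t x))\<^sup>2" if "t \<in> S" for t
  proof (rule order_trans[OF w_le], rule LIMSEQ_le_const[OF lim[OF S2[OF that]]])
    show "\<exists>N. \<forall>n\<ge>N. d \<le> (l2_dist M (\<lambda>x. s n x + t x) h)\<^sup>2"
      using d_le[OF lin[OF s that, of _ 1]] by simp
  qed
  have orth: "l2_inner M t w = 0" if t: "t \<in> S" for t
  proof -
    define z where "z = l2_inner M w t"
    (* Unless z = 0, a step - e * z * t with 0 < e < 2 / norm t ^ 2 decreases the norm of w;
       the 1 in the denominator covers t = 0. *)
    define e where "e = 1 / (1 + (l2_norm M t)\<^sup>2)"
    have e: "0 < e" "e * (l2_norm M t)\<^sup>2 < 1"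
      by (simp_all add: e_def add_pos_nonneg divide_simps)
    let ?t = "\<lambda>x. (- complex_of_real e * z) * t x"
    have "(l2_norm M w)\<^sup>2 \<le> (l2_norm M w)\<^sup>2 + 2 * Re (l2_inner M w ?t) + (l2_norm M ?t)\<^sup>2"
      using min[OF scale[OF t]] by (simp only: l2_norm_add_sq[OF w L2_scale[OF S2[OF t]]])
    moreover have "Re (l2_inner M w ?t) = - e * (cmod z)\<^sup>2"
    proof -
      have "l2_inner M w ?t = - complex_of_real e * (z * cnj z)"
        by (simp only: l2_inner_scale_right) (simp add: z_def)
      also have "\<dots> = complex_of_real (- e * (cmod z)\<^sup>2)"
        by (simp add: complex_norm_square[symmetric])
      finally show ?thesis by (simp only: Re_complex_of_real)
    qed
    moreover have "(l2_norm M ?t)\<^sup>2 = e\<^sup>2 * (cmod z)\<^sup>2 * (l2_norm M t)\<^sup>2"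
      using e(1) by (simp only: l2_norm_scale) (simp add: norm_mult power_mult_distrib)
    ultimately have "0 \<le> e * (cmod z)\<^sup>2 * (e * (l2_norm M t)\<^sup>2 - 2)"
      by (simp add: power2_eq_square algebra_simps)
    moreover have "e * (cmod z)\<^sup>2 * (e * (l2_norm M t)\<^sup>2 - 2) < 0" if "z \<noteq> 0"
      using that e by (intro mult_pos_neg) simp_all
    ultimately have "z = 0" by fastforce
    then show ?thesis using l2_inner_commute[of M t w] by (simp add: z_def)
  qed
  have "AE x in M. w x = 0" using triv[OF w orth] .
  then have "l2_dist M r h = 0"
    unfolding l2_dist_def w_def by (subst integral_cong_AE[where g="\<lambda>x. 0"]) (use r h in auto)
  then have "l2_dist M (s n) h \<le> l2_dist M (s n) r" for n
    using l2_dist_triangle[OF sL2 r h, of n] by simp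
  then have "(\<lambda>n. l2_dist M (s n) h) \<longlonglongrightarrow> 0"
    by (intro Lim_null_comparison[OF _ r_lim]) simp
  then show ?thesis using s by blast
qed

section \<open>Operators and their adjoints\<close>

lemma densely_defined_orthogonal_imp_zero:
  assumes T: "T \<subseteq> L2 M \<times> L2 M" "densely_defined M T"
    and g: "g \<in> L2 M" and orth: "\<And>h k. (h, k) \<in> T \<Longrightarrow> l2_inner M h g = 0"
  shows "AE x in M. g x = 0"
proof -
  have "\<exists>h\<in>Domain T. l2_dist M g h < 1 / real (Suc n)" for n
    using T(2) g unfolding densely_defined_def by simp
  then obtain h where h: "\<And>n. h n \<in> Domain T" "\<And>n. l2_dist M g (h n) < 1 / real (Suc n)" by metis
  have hL2: "h n \<in> L2 M" for n using h(1)[of n] T(1) by auto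
  have "(\<lambda>n. l2_dist M (h n) g) \<longlonglongrightarrow> 0"
  proof (rule Lim_null_comparison)
    show "\<forall>\<^sub>F n in sequentially. norm (l2_dist M (h n) g) \<le> 1 / real (Suc n)"
      using h(2) by (simp add: l2_dist_commute[of M g] less_imp_le)
    show "(\<lambda>n. 1 / real (Suc n)) \<longlonglongrightarrow> 0"
      using LIMSEQ_inverse_real_of_nat by (simp add: inverse_eq_divide)
  qed
  then have "(\<lambda>n. l2_inner M (h n) g) \<longlonglongrightarrow> l2_inner M g g"
    by (rule l2_inner_tendsto_left[OF hL2 g g])
  moreover have "l2_inner M (h n) g = 0" for n using h(1)[of n] orth by auto
  ultimately have "l2_inner M g g = 0" using LIMSEQ_unique[OF _ tendsto_const] by simp
  then show ?thesis using l2_norm_eq_0_AE[OF g] by (simp add: l2_inner_self)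
qed

lemma linear_operatorD:
  assumes T: "linear_operator M T"
  shows linear_operator_subset: "T \<subseteq> L2 M \<times> L2 M"
    and linear_operator_lincomb: "(f, g) \<in> T \<Longrightarrow> (f', g') \<in> T \<Longrightarrow>
      ((\<lambda>x. f x + a * f' x), (\<lambda>x. g x + a * g' x)) \<in> T"
    and linear_operator_unique: "(f, g) \<in> T \<Longrightarrow> (f', g') \<in> T \<Longrightarrow>
      AE x in M. f x = f' x \<Longrightarrow> AE x in M. g x = g' x"
proof -
  note c1 = T[unfolded linear_operator_def, THEN conjunct2, THEN conjunct2]
  note add = c1[THEN conjunct1, rule_format] and c2 = c1[THEN conjunct2]
  note scale = c2[THEN conjunct1, rule_format] and c3 = c2[THEN conjunct2]
  show "T \<subseteq> L2 M \<times> L2 M" using T unfolding linear_operator_def by (rule conjunct1)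
  show "((\<lambda>x. f x + a * f' x), (\<lambda>x. g x + a * g' x)) \<in> T" if "(f, g) \<in> T" "(f', g') \<in> T"
    by (rule add[OF that(1) scale[OF that(2)]])
  show "AE x in M. g x = g' x" if "(f, g) \<in> T" "(f', g') \<in> T" "AE x in M. f x = f' x"
    using c3[THEN conjunct2, rule_format, OF that] .
qed

lemma adjoint_operatorI:
  "f \<in> L2 M \<Longrightarrow> g \<in> L2 M \<Longrightarrow> (\<And>h k. (h, k) \<in> T \<Longrightarrow> l2_inner M k f = l2_inner M h g) \<Longrightarrow>
    (f, g) \<in> adjoint_operator M T"
  by (auto simp: adjoint_operator_def)

lemma adjoint_operatorD:
  assumes "(f, g) \<in> adjoint_operator M T"
  shows "f \<in> L2 M" "g \<in> L2 M" "(h, k) \<in> T \<Longrightarrow> l2_inner M k f = l2_inner M h g"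
  using assms by (auto simp: adjoint_operator_def)

lemma linear_operator_adjoint:
  assumes T: "T \<subseteq> L2 M \<times> L2 M" "densely_defined M T"
  shows "linear_operator M (adjoint_operator M T)"
proof -
  let ?A = "adjoint_operator M T"
  have TL2: "h \<in> L2 M" "k \<in> L2 M" if "(h, k) \<in> T" for h k using T(1) that by auto
  have add: "((\<lambda>x. f x + a * f' x), (\<lambda>x. g x + a * g' x)) \<in> ?A"
    if 1: "(f, g) \<in> ?A" and 2: "(f', g') \<in> ?A" for f g f' g' a
    using adjoint_operatorD(1,2)[OF 1] adjoint_operatorD(1,2)[OF 2]
    by (intro adjoint_operatorI L2_add L2_scale)
       (auto simp: l2_inner_add_right L2_scale TL2 l2_inner_scale_right
          adjoint_operatorD(3)[OF 1] adjoint_operatorD(3)[OF 2])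
  have zero: "((\<lambda>x. 0), (\<lambda>x. 0)) \<in> ?A" by (intro adjoint_operatorI) auto
  have cong: "(f', g') \<in> ?A" if 1: "(f, g) \<in> ?A" and "f' \<in> L2 M" "g' \<in> L2 M"
    "AE x in M. f x = f' x" "AE x in M. g x = g' x" for f g f' g'
  proof (rule adjoint_operatorI)
    fix h k assume hk: "(h, k) \<in> T"
    have "l2_inner M k f' = l2_inner M k f"
      using that TL2[OF hk] adjoint_operatorD(1)[OF 1] by (intro l2_inner_cong_AE) auto
    moreover have "l2_inner M h g' = l2_inner M h g"
      using that TL2[OF hk] adjoint_operatorD(2)[OF 1] by (intro l2_inner_cong_AE) auto
    ultimately show "l2_inner M k f' = l2_inner M h g'" using adjoint_operatorD(3)[OF 1 hk] by simp
  qed (use that in auto)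
  have unique: "AE x in M. g x = g' x"
    if 1: "(f, g) \<in> ?A" and 2: "(f', g') \<in> ?A" and eq: "AE x in M. f x = f' x" for f g f' g'
  proof -
    note L = adjoint_operatorD(1,2)[OF 1] adjoint_operatorD(1,2)[OF 2]
    have "AE x in M. g x - g' x = 0"
    proof (rule densely_defined_orthogonal_imp_zero[OF T])
      fix h k assume hk: "(h, k) \<in> T"
      have "l2_inner M k f = l2_inner M k f'"
        using eq L TL2[OF hk] by (intro l2_inner_cong_AE) auto
      then show "l2_inner M h (\<lambda>x. g x - g' x) = 0"
        using L TL2[OF hk] adjoint_operatorD(3)[OF 1 hk] adjoint_operatorD(3)[OF 2 hk]
        by (simp add: l2_inner_diff_right)
    qed (use L in \<open>auto intro: L2_diff\<close>)
    then show ?thesis by eventually_elim simp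
  qed
  show ?thesis
    unfolding linear_operator_def
  proof (intro conjI allI impI)
    show "?A \<subseteq> L2 M \<times> L2 M" by (auto dest: adjoint_operatorD)
    show "((\<lambda>x. f x + f' x), (\<lambda>x. g x + g' x)) \<in> ?A" if "(f, g) \<in> ?A" "(f', g') \<in> ?A" for f g f' g'
      using add[OF that, of 1] by simp
    show "((\<lambda>x. a * f x), (\<lambda>x. a * g x)) \<in> ?A" if "(f, g) \<in> ?A" for f g a
      using add[OF zero that, of a] by simp
  qed (fact zero, (erule (4) cong), (erule (2) unique))
qed

lemma subset_closure_operator: "T \<subseteq> L2 M \<times> L2 M \<Longrightarrow> T \<subseteq> closure_operator M T"
  unfolding closure_operator_def
  by (auto intro!: exI[where x="\<lambda>n. _"] simp: l2_dist_def)

text \<open>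
  The equation that defines the adjoint is stable under limits by the continuity of the inner product.
\<close>

lemma adjoint_closure_operator:
  assumes T: "T \<subseteq> L2 M \<times> L2 M"
  shows "adjoint_operator M (closure_operator M T) = adjoint_operator M T"
proof
  show "adjoint_operator M (closure_operator M T) \<subseteq> adjoint_operator M T"
    using subset_closure_operator[OF T] unfolding adjoint_operator_def by blast
  show "adjoint_operator M T \<subseteq> adjoint_operator M (closure_operator M T)"
  proof safe
    fix f g assume fg: "(f, g) \<in> adjoint_operator M T"
    note L = adjoint_operatorD(1,2)[OF fg]
    show "(f, g) \<in> adjoint_operator M (closure_operator M T)"
    proof (rule adjoint_operatorI[OF L])
      fix h k assume "(h, k) \<in> closure_operator M T"
      then obtain h' k' where hk: "h \<in> L2 M" "k \<in> L2 M" "\<And>n. (h' n, k' n) \<in> T"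
        "(\<lambda>n. l2_dist M (h' n) h) \<longlonglongrightarrow> 0" "(\<lambda>n. l2_dist M (k' n) k) \<longlonglongrightarrow> 0"
        unfolding closure_operator_def by auto
      have L': "h' n \<in> L2 M" "k' n \<in> L2 M" for n using hk(3) T by auto
      have "(\<lambda>n. l2_inner M (k' n) f) \<longlonglongrightarrow> l2_inner M k f"
        by (rule l2_inner_tendsto_left[OF L'(2) hk(2) L(1) hk(5)])
      moreover have "(\<lambda>n. l2_inner M (h' n) g) \<longlonglongrightarrow> l2_inner M h g"
        by (rule l2_inner_tendsto_left[OF L'(1) hk(1) L(2) hk(4)])
      moreover have "l2_inner M (k' n) f = l2_inner M (h' n) g" for n
        by (rule adjoint_operatorD(3)[OF fg hk(3)])
      ultimately show "l2_inner M k f = l2_inner M h g" using LIMSEQ_unique by simp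
    qed
  qed
qed

lemma closure_operator_subset_adjoint:
  assumes T: "symmetric_operator M T"
  shows "closure_operator M T \<subseteq> adjoint_operator M T"
proof safe
  fix f g assume "(f, g) \<in> closure_operator M T"
  then obtain h k where hk: "f \<in> L2 M" "g \<in> L2 M" "\<And>n. (h n, k n) \<in> T"
      "(\<lambda>n. l2_dist M (h n) f) \<longlonglongrightarrow> 0" "(\<lambda>n. l2_dist M (k n) g) \<longlonglongrightarrow> 0"
    unfolding closure_operator_def by auto
  have L: "\<And>f g. (f, g) \<in> T \<Longrightarrow> f \<in> L2 M \<and> g \<in> L2 M"
    using T unfolding symmetric_operator_def linear_operator_def by auto
  show "(f, g) \<in> adjoint_operator M T"
  proof (rule adjoint_operatorI[OF hk(1,2)])
    fix u v assume uv: "(u, v) \<in> T"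
    have "(\<lambda>n. l2_inner M (k n) u) \<longlonglongrightarrow> l2_inner M g u" "(\<lambda>n. l2_inner M (h n) v) \<longlonglongrightarrow> l2_inner M f v"
      using L hk uv by (blast intro: l2_inner_tendsto_left)+
    moreover have "l2_inner M (k n) u = l2_inner M (h n) v" for n
      using T hk(3)[of n] uv unfolding symmetric_operator_def by auto
    ultimately have "l2_inner M g u = l2_inner M f v" using LIMSEQ_unique by simp
    then show "l2_inner M v f = l2_inner M u g"
      by (simp add: l2_inner_commute[of M v] l2_inner_commute[of M u])
  qed
qed

text \<open>
  The cross term \<open>2 * Re \<langle>g, \<i> f\<rangle> = 2 * Im \<langle>g, f\<rangle>\<close> vanishes because \<open>\<langle>T f, f\<rangle>\<close> is real.  Hence \<open>T + \<i>\<close>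
  is bounded below, which lets one pass from convergence of \<open>(T + \<i>) (u n)\<close> to convergence of
  \<open>u n\<close>.
\<close>

lemma symmetric_operator_norm_plus_ii:
  assumes T: "symmetric_operator M T" and fg: "(f, g) \<in> T"
  shows "(l2_norm M (\<lambda>x. g x + \<i> * f x))\<^sup>2 = (l2_norm M g)\<^sup>2 + (l2_norm M f)\<^sup>2"
proof -
  have L: "f \<in> L2 M" "g \<in> L2 M"
    using fg T unfolding symmetric_operator_def linear_operator_def by auto
  have "l2_inner M g f = cnj (l2_inner M g f)"
    using T fg l2_inner_commute[of M f g] unfolding symmetric_operator_def by fastforce
  then have "Im (l2_inner M g f) = 0" by (simp add: complex_eq_iff)
  then show ?thesis
    by (simp add: l2_norm_add_sq L L2_scale l2_inner_scale_right l2_norm_scale)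
qed

text \<open>
  Given \<open>(f, g)\<close> in the graph of the adjoint, the first assumption makes the range of \<open>T + \<i>\<close> dense, so
  \<open>g + \<i> f\<close> is the limit of some \<open>(T + \<i>) (u n)\<close>.  Then \<open>u n\<close> converges to some \<open>d\<close> in the domain of the
  closure with \<open>(T\<^sup>* + \<i>) (f - d) = 0\<close>, and the second assumption gives \<open>f = d\<close>.  So the closure is
  the whole adjoint, and the adjoint of the closure is the adjoint of \<open>T\<close>.
\<close>

theorem essentially_self_adjoint_if_deficiency_trivial:
  assumes T: "symmetric_operator M T"
    and plus: "\<And>f. (f, \<lambda>x. \<i> * f x) \<in> adjoint_operator M T \<Longrightarrow> AE x in M. f x = 0"
    and minus: "\<And>f. (f, \<lambda>x. - \<i> * f x) \<in> adjoint_operator M T \<Longrightarrow> AE x in M. f x = 0"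
  shows "essentially_self_adjoint M T"
proof -
  let ?A = "adjoint_operator M T" and ?C = "closure_operator M T"
  have lin: "linear_operator M T" and dense: "densely_defined M T"
    using T by (auto simp: symmetric_operator_def)
  have sub: "T \<subseteq> L2 M \<times> L2 M" using lin by (rule linear_operator_subset)
  have L: "f \<in> L2 M" "g \<in> L2 M" if "(f, g) \<in> T" for f g using sub that by auto
  have Tadd: "((\<lambda>x. f x + a * f' x), (\<lambda>x. g x + a * g' x)) \<in> T"
    if "(f, g) \<in> T" "(f', g') \<in> T" for f g f' g' a
    using lin that by (rule linear_operator_lincomb)
  have linA: "linear_operator M ?A" using sub dense by (rule linear_operator_adjoint)
  define R where "R = {(\<lambda>x. k x + \<i> * h x) | h k. (h, k) \<in> T}"
  have R_dense: "\<exists>s. (\<forall>n. s n \<in> R) \<and> (\<lambda>n::nat. l2_dist M (s n) h) \<longlonglongrightarrow> 0" if h: "h \<in> L2 M" for h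
  proof (rule dense_if_orthogonal_complement_trivial[OF _ _ _ _ h])
    show "R \<subseteq> L2 M" by (auto simp: R_def intro!: L2_add L2_scale dest: L)
    show "R \<noteq> {}" using lin by (auto simp: R_def linear_operator_def)
    show "(\<lambda>x. f x + a * g x) \<in> R" if f: "f \<in> R" and g: "g \<in> R" for f g a
    proof -
      obtain h k h' k' where "(h, k) \<in> T" "f = (\<lambda>x. k x + \<i> * h x)" "(h', k') \<in> T" "g = (\<lambda>x. k' x + \<i> * h' x)"
        using f g unfolding R_def by blast
      then show ?thesis unfolding R_def
        by (intro CollectI exI[where x="\<lambda>x. h x + a * h' x"] exI[where x="\<lambda>x. k x + a * k' x"])
          (auto simp: Tadd algebra_simps)
    qed
    fix f assume f: "f \<in> L2 M" and orth: "\<And>s. s \<in> R \<Longrightarrow> l2_inner M s f = 0"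
    have "(f, \<lambda>x. \<i> * f x) \<in> ?A"
    proof (rule adjoint_operatorI)
      fix h k assume hk: "(h, k) \<in> T"
      have "l2_inner M (\<lambda>x. k x + \<i> * h x) f = 0" using hk by (intro orth) (auto simp: R_def)
      then show "l2_inner M k f = l2_inner M h (\<lambda>x. \<i> * f x)"
        using L[OF hk] f
        by (simp add: l2_inner_add_left L2_scale l2_inner_scale_left l2_inner_scale_right add_eq_0_iff)
    qed (use f in \<open>auto intro: L2_scale\<close>)
    then show "AE x in M. f x = 0" by (rule plus)
  qed
  have "?A \<subseteq> ?C"
  proof safe
    fix f g assume fg: "(f, g) \<in> ?A"
    note Lfg = adjoint_operatorD(1,2)[OF fg]
    define h where "h x = g x + \<i> * f x" for x
    have h: "h \<in> L2 M" unfolding h_def using Lfg by (intro L2_add L2_scale)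
    obtain s where s: "\<And>n. s n \<in> R" "(\<lambda>n::nat. l2_dist M (s n) h) \<longlonglongrightarrow> 0" using R_dense[OF h] by auto
    have "\<exists>u v. (u, v) \<in> T \<and> s n = (\<lambda>x. v x + \<i> * u x)" for n using s(1)[of n] by (auto simp: R_def)
    then obtain u v where uv: "\<And>n. (u n, v n) \<in> T" and s_eq: "\<And>n. s n = (\<lambda>x. v n x + \<i> * u n x)" by metis
    note Lu = L(1)[OF uv] and Lv = L(2)[OF uv]
    have Ls: "s n \<in> L2 M" for n unfolding s_eq by (intro L2_add L2_scale Lu Lv)
    have diff: "(l2_dist M (s m) (s n))\<^sup>2 = (l2_dist M (v m) (v n))\<^sup>2 + (l2_dist M (u m) (u n))\<^sup>2" for m n
    proof -
      have eq: "(\<lambda>x. s m x - s n x) = (\<lambda>x. (v m x - v n x) + \<i> * (u m x - u n x))"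
        by (simp add: s_eq fun_eq_iff algebra_simps)
      have "((\<lambda>x. u m x - u n x), (\<lambda>x. v m x - v n x)) \<in> T"
        using Tadd[OF uv uv, of m "-1" n] by simp
      then show ?thesis
        unfolding l2_dist_eq_norm eq by (rule symmetric_operator_norm_plus_ii[OF T])
    qed
    have "\<exists>d\<in>L2 M. (\<lambda>n. l2_dist M (u n) d) \<longlonglongrightarrow> 0"
    proof (rule L2_complete[OF Lu])
      fix e :: real assume e: "0 < e"
      then obtain N where N: "\<And>n. N \<le> n \<Longrightarrow> l2_dist M (s n) h < e / 2"
        using order_tendstoD(2)[OF s(2), of "e / 2"] by (auto simp: eventually_sequentially)
      have "l2_dist M (u m) (u n) < e" if "N \<le> m" "N \<le> n" for m n
      proof -
        have "l2_dist M (u m) (u n) \<le> l2_dist M (s m) (s n)"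
          by (rule power2_le_imp_le) (simp_all add: diff)
        also have "\<dots> \<le> l2_dist M (s m) h + l2_dist M h (s n)"
          by (rule l2_dist_triangle[OF Ls h Ls])
        also have "\<dots> < e" using N[OF that(1)] N[OF that(2)] by (simp add: l2_dist_commute[of M h])
        finally show ?thesis .
      qed
      then show "\<exists>N. \<forall>m\<ge>N. \<forall>n\<ge>N. l2_dist M (u m) (u n) < e" by blast
    qed
    then obtain d where d: "d \<in> L2 M" and d_lim: "(\<lambda>n. l2_dist M (u n) d) \<longlonglongrightarrow> 0" by blast
    define p where "p x = h x - \<i> * d x" for x
    have p: "p \<in> L2 M" unfolding p_def using h d by (intro L2_diff L2_scale)
    have p_lim: "(\<lambda>n. l2_dist M (v n) p) \<longlonglongrightarrow> 0"
    proof (rule Lim_null_comparison)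
      show "(\<lambda>n. l2_dist M (s n) h + l2_dist M (u n) d) \<longlonglongrightarrow> 0"
        using tendsto_add[OF s(2) d_lim] by simp
      have "l2_dist M (v n) p \<le> l2_dist M (s n) h + l2_dist M (u n) d" for n
      proof -
        have "(\<lambda>x. v n x - p x) = (\<lambda>x. (s n x - h x) + (- \<i>) * (u n x - d x))"
          by (simp add: s_eq p_def fun_eq_iff algebra_simps)
        then have "l2_dist M (v n) p = l2_norm M (\<lambda>x. (s n x - h x) + (- \<i>) * (u n x - d x))"
          by (simp add: l2_dist_eq_norm)
        also have "\<dots> \<le> l2_norm M (\<lambda>x. s n x - h x) + l2_norm M (\<lambda>x. (- \<i>) * (u n x - d x))"
          by (intro l2_norm_triangle L2_diff L2_scale Ls h Lu d)
        also have "\<dots> = l2_dist M (s n) h + l2_dist M (u n) d"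
          by (simp only: l2_norm_scale l2_dist_eq_norm) simp
        finally show ?thesis .
      qed
      then show "\<forall>\<^sub>F n in sequentially. norm (l2_dist M (v n) p) \<le> l2_dist M (s n) h + l2_dist M (u n) d"
        by simp
    qed
    have dp: "(d, p) \<in> ?C"
      unfolding closure_operator_def using d p uv d_lim p_lim by blast
    then have dpA: "(d, p) \<in> ?A" using closure_operator_subset_adjoint[OF T] by auto
    have "((\<lambda>x. f x + -1 * d x), (\<lambda>x. g x + -1 * p x)) \<in> ?A"
      using linA fg dpA by (rule linear_operator_lincomb)
    moreover have "(\<lambda>x. g x + -1 * p x) = (\<lambda>x. - \<i> * (f x + -1 * d x))"
      by (simp add: p_def h_def fun_eq_iff algebra_simps)
    ultimately have "AE x in M. f x + -1 * d x = 0" by (intro minus) simp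
    then have fd: "AE x in M. d x = f x" by eventually_elim simp
    then have gp: "AE x in M. p x = g x"
      by (rule linear_operator_unique[OF linA dpA fg])
    have "l2_dist M (u n) f = l2_dist M (u n) d" for n
      unfolding l2_dist_def
      by (intro arg_cong[where f=sqrt] integral_cong_AE) (use Lu[of n] d Lfg fd in auto)
    moreover have "l2_dist M (v n) g = l2_dist M (v n) p" for n
      unfolding l2_dist_def
      by (intro arg_cong[where f=sqrt] integral_cong_AE) (use Lv[of n] p Lfg gp in auto)
    ultimately have "(\<lambda>n. l2_dist M (u n) f) \<longlonglongrightarrow> 0" "(\<lambda>n. l2_dist M (v n) g) \<longlonglongrightarrow> 0"
      using d_lim p_lim by simp_all
    then show "(f, g) \<in> ?C"
      unfolding closure_operator_def using Lfg uv by blast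
  qed
  then have eq: "?C = ?A" using closure_operator_subset_adjoint[OF T] by blast
  have "densely_defined M ?C"
    using dense subset_closure_operator[OF sub] unfolding densely_defined_def by (meson Domain_mono subsetD)
  then have "self_adjoint_operator M ?C"
    using linA adjoint_closure_operator[OF sub] unfolding self_adjoint_operator_def eq by simp
  then show ?thesis using T by (simp add: essentially_self_adjoint_def)
qed

section \<open>Simple functions of finite-measure support\<close>

lemma D_finI:
  fixes n :: nat
  assumes "\<And>i. i < n \<Longrightarrow> A i \<in> sets M \<and> emeasure M (A i) < \<infinity>"
  shows "(\<lambda>x. \<Sum>i<n. a i * indicator (A i) x) \<in> D_fin M"
  unfolding D_fin_def using assms by (intro CollectI exI[where x=n] exI[where x=a] exI[where x=A]) simp

lemma D_finE:
  assumes "f \<in> D_fin M"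
  obtains n :: nat and a A where "\<And>i. i < n \<Longrightarrow> A i \<in> sets M \<and> emeasure M (A i) < \<infinity>"
    "f = (\<lambda>x. \<Sum>i<n. a i * indicator (A i) x)"
proof -
  obtain n :: nat and a A where *: "\<forall>i<n. A i \<in> sets M \<and> emeasure M (A i) < \<infinity>"
      "f = (\<lambda>x. \<Sum>i<n. a i * indicator (A i) x)"
    using assms unfolding D_fin_def mem_Collect_eq by (elim exE conjE)
  show thesis by (rule that[OF *(1)[rule_format] *(2)])
qed

lemma D_fin_indicator:
  "A \<in> sets M \<Longrightarrow> emeasure M A < \<infinity> \<Longrightarrow> indicator A \<in> D_fin M"
  using D_finI[of 1 "\<lambda>_. A" M "\<lambda>_. 1"] by simp

lemma D_fin_zero: "(\<lambda>x. 0) \<in> D_fin M"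
  using D_finI[of 0 "\<lambda>_. {}" M] by simp

lemma D_fin_lincomb:
  assumes "f \<in> D_fin M" "g \<in> D_fin M"
  shows "(\<lambda>x. f x + a * g x) \<in> D_fin M"
proof -
  obtain n :: nat and b A where f: "\<And>i. i < n \<Longrightarrow> A i \<in> sets M \<and> emeasure M (A i) < \<infinity>"
    "f = (\<lambda>x. \<Sum>i<n. b i * indicator (A i) x)" using assms(1) by (elim D_finE) (rule that, assumption+)
  obtain m :: nat and c B where g: "\<And>i. i < m \<Longrightarrow> B i \<in> sets M \<and> emeasure M (B i) < \<infinity>"
    "g = (\<lambda>x. \<Sum>i<m. c i * indicator (B i) x)" using assms(2) by (elim D_finE) (rule that, assumption+)
  let ?b = "\<lambda>i. if i < n then b i else a * c (i - n)" and ?A = "\<lambda>i. if i < n then A i else B (i - n)"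
  have split: "(\<Sum>i<n+m. h i) = (\<Sum>i<n. h i) + (\<Sum>i<m. h (n + i))" for h :: "nat \<Rightarrow> complex"
    by (induction m) (simp_all add: add.assoc)
  have "(\<lambda>x. f x + a * g x) = (\<lambda>x. \<Sum>i<n+m. ?b i * indicator (?A i) x)"
    unfolding f(2) g(2) split sum_distrib_left mult.assoc[symmetric] by simp
  moreover have "\<forall>i<n+m. ?A i \<in> sets M \<and> emeasure M (?A i) < \<infinity>"
    using f(1) g(1) by auto
  ultimately show ?thesis using D_finI[of "n+m" ?A M ?b] by simp
qed

lemma D_fin_induct [consumes 1, case_names zero step]:
  assumes "f \<in> D_fin M"
    and zero: "P (\<lambda>x. 0)"
    and step: "\<And>g a A. g \<in> D_fin M \<Longrightarrow> P g \<Longrightarrow> A \<in> sets M \<Longrightarrow> emeasure M A < \<infinity> \<Longrightarrow>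
      P (\<lambda>x. g x + a * indicator A x)"
  shows "P f"
proof -
  obtain n :: nat and a A where A: "\<And>i. i < n \<Longrightarrow> A i \<in> sets M \<and> emeasure M (A i) < \<infinity>"
    and f: "f = (\<lambda>x. \<Sum>i<n. a i * indicator (A i) x)"
    using assms(1) by (elim D_finE) (rule that, assumption+)
  have "(\<lambda>x. \<Sum>i<k. a i * indicator (A i) x) \<in> D_fin M \<and> P (\<lambda>x. \<Sum>i<k. a i * indicator (A i) x)" if "k \<le> n" for k
    using that
  proof (induction k)
    case 0
    show ?case using zero D_fin_zero by simp
  next
    case (Suc k)
    then have "A k \<in> sets M" "emeasure M (A k) < \<infinity>" using A by auto
    with Suc show ?case by (simp add: step D_fin_lincomb D_fin_indicator)
  qed
  from this[of n] show ?thesis unfolding f by blast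
qed

lemma D_fin_sum:
  assumes "finite I" "\<And>i. i \<in> I \<Longrightarrow> A i \<in> sets M \<and> emeasure M (A i) < \<infinity>"
  shows "(\<lambda>x. \<Sum>i\<in>I. a i * indicator (A i) x) \<in> D_fin M"
  using assms
proof (induction I)
  case empty
  then show ?case by (simp add: D_fin_zero)
next
  case (insert i I)
  then have "(\<lambda>x. (\<Sum>i\<in>I. a i * indicator (A i) x) + a i * indicator (A i) x) \<in> D_fin M"
    by (intro D_fin_lincomb D_fin_indicator) auto
  then show ?case by (simp only: sum.insert[OF insert(1,2)] add.commute)
qed

lemma D_fin_subset_L2: "D_fin M \<subseteq> L2 M"
proof
  fix f assume "f \<in> D_fin M"
  then show "f \<in> L2 M"
  proof (induction rule: D_fin_induct)
    case (step g a A)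
    have "(\<lambda>x. (cmod (indicator A x))\<^sup>2) = indicator A" by (auto simp: indicator_def)
    then have "indicator A \<in> L2 M"
      using step.hyps by (simp add: L2_def)
    then show ?case using step by (intro L2_add L2_scale)
  qed simp
qed

lemma L2_level_set_finite:
  assumes f: "f \<in> L2 M" and e: "0 < e"
  shows "emeasure M {x\<in>space M. e \<le> cmod (f x)} < \<infinity>"
proof -
  have "{x\<in>space M. e \<le> cmod (f x)} = {x\<in>space M. e\<^sup>2 \<le> (cmod (f x))\<^sup>2}"
    using e by (auto intro: power_mono dest: power2_le_imp_le)
  also have "emeasure M \<dots> \<le> ennreal (1 / e\<^sup>2 * (\<integral>x. (cmod (f x))\<^sup>2 \<partial>M))"
    using e by (intro integral_Markov_inequality L2_integrable f) simp_all
  also have "\<dots> < \<infinity>" by simp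
  finally show ?thesis .
qed

text \<open>
  The bound by \<open>2 * \<bar>f\<bar>\<close> serves twice: it gives finite measure to the level sets of the approximating
  simple functions at nonzero values, and it is the majorant for dominated convergence.
\<close>

lemma L2_approx_D_fin:
  assumes f: "f \<in> L2 M"
  shows "\<exists>F. (\<forall>n. F n \<in> D_fin M) \<and>
    (\<forall>x\<in>space M. (\<lambda>n::nat. F n x) \<longlonglongrightarrow> f x \<and> (\<forall>n. cmod (F n x) \<le> 2 * cmod (f x)))"
proof -
  have [measurable]: "f \<in> borel_measurable M" using f by (simp add: L2_def)
  obtain s where s: "\<And>n. simple_function M (s n)" "\<And>x. x \<in> space M \<Longrightarrow> (\<lambda>n. s n x) \<longlonglongrightarrow> f x"
    "\<And>n x. x \<in> space M \<Longrightarrow> dist (s n x) 0 \<le> 2 * dist (f x) 0"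
    using borel_measurable_implies_sequence_metric[OF \<open>f \<in> borel_measurable M\<close>, of 0] by metis
  (* The elements of D_fin vanish outside the space, so s n is rebuilt from its level sets there. *)
  define F where "F n x = (\<Sum>y\<in>s n ` space M - {0}. y * indicator (s n -` {y} \<inter> space M) x)" for n x
  have F_eq: "F n x = s n x" if x: "x \<in> space M" for n x
  proof -
    have fin: "finite (s n ` space M - {0})" using s(1)[of n] by (simp add: simple_function_def)
    have "F n x = (\<Sum>y\<in>s n ` space M - {0}. if y = s n x then s n x else 0)"
      unfolding F_def using x by (intro sum.cong) (auto simp: indicator_def)
    also have "\<dots> = s n x" using fin x by (simp add: sum.delta)
    finally show ?thesis .
  qed
  have "F n \<in> D_fin M" for n
  proof -
    have "(\<lambda>x. \<Sum>y\<in>s n ` space M - {0}. y * indicator (s n -` {y} \<inter> space M) x) \<in> D_fin M"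
    proof (rule D_fin_sum)
      show "finite (s n ` space M - {0})" using s(1)[of n] by (simp add: simple_function_def)
      fix y assume y: "y \<in> s n ` space M - {0}"
      let ?S = "s n -` {y} \<inter> space M"
      have S: "?S \<in> sets M" using s(1)[of n] y by (auto simp: simple_function_def)
      have "emeasure M ?S \<le> emeasure M {x\<in>space M. cmod y / 2 \<le> cmod (f x)}"
      proof (rule emeasure_mono)
        show "?S \<subseteq> {x\<in>space M. cmod y / 2 \<le> cmod (f x)}"
          using s(3)[of _ n] by (auto simp: mult.commute)
      qed measurable
      also have "\<dots> < \<infinity>"
        using y by (intro L2_level_set_finite[OF f]) simp
      finally show "?S \<in> sets M \<and> emeasure M ?S < \<infinity>" using S by simp
    qed
    then show ?thesis by (simp add: F_def[abs_def])
  qed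
  then show ?thesis using s(2,3) F_eq by (intro exI[where x=F]) (auto simp: F_eq)
qed

lemma D_fin_dense:
  assumes f: "f \<in> L2 M" and e: "0 < e"
  shows "\<exists>h\<in>D_fin M. l2_dist M f h < e"
proof -
  obtain F where F: "\<And>n::nat. F n \<in> D_fin M" "\<And>x. x \<in> space M \<Longrightarrow> (\<lambda>n. F n x) \<longlonglongrightarrow> f x"
    "\<And>n x. x \<in> space M \<Longrightarrow> cmod (F n x) \<le> 2 * cmod (f x)"
    using L2_approx_D_fin[OF f] by metis
  have [measurable]: "f \<in> borel_measurable M" "F n \<in> borel_measurable M" for n
    using f F(1)[of n] D_fin_subset_L2[of M] by (auto simp: L2_def)
  have "(\<lambda>n. \<integral>x. (cmod (f x - F n x))\<^sup>2 \<partial>M) \<longlonglongrightarrow> (\<integral>x. 0 \<partial>M)"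
  proof (rule integral_dominated_convergence)
    show "integrable M (\<lambda>x. 9 * (cmod (f x))\<^sup>2)" using L2_integrable[OF f] by simp
    show "AE x in M. (\<lambda>n. (cmod (f x - F n x))\<^sup>2) \<longlonglongrightarrow> 0"
    proof (rule AE_I2)
      fix x assume x: "x \<in> space M"
      have "(\<lambda>n. f x - F n x) \<longlonglongrightarrow> f x - f x" by (intro tendsto_diff tendsto_const F(2) x)
      from tendsto_power[OF tendsto_norm[OF this], of 2]
      show "(\<lambda>n. (cmod (f x - F n x))\<^sup>2) \<longlonglongrightarrow> 0" by simp
    qed
    show "AE x in M. norm ((cmod (f x - F n x))\<^sup>2) \<le> 9 * (cmod (f x))\<^sup>2" for n
    proof (rule AE_I2)
      fix x assume x: "x \<in> space M"
      have "cmod (f x - F n x) \<le> 3 * cmod (f x)"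
        using norm_triangle_ineq4[of "f x" "F n x"] F(3)[OF x, of n] by simp
      from power_mono[OF this, of 2] show "norm ((cmod (f x - F n x))\<^sup>2) \<le> 9 * (cmod (f x))\<^sup>2"
        by (simp add: power_mult_distrib)
    qed
  qed simp_all
  then have "(\<lambda>n. l2_dist M f (F n)) \<longlonglongrightarrow> 0"
    unfolding l2_dist_def using tendsto_real_sqrt[of _ 0] by simp
  from order_tendstoD(2)[OF this e] have "\<exists>n. l2_dist M f (F n) < e"
    unfolding eventually_sequentially by blast
  then show ?thesis using F(1) by blast
qed

section \<open>Integration against a symmetric measure\<close>

context symmetric_measure_graph
begin

lemmas rho_sets_cong [measurable_cong] = sets_rho

lemma space_rho: "space rho = space mu \<times> space mu"
  using sets_eq_imp_space_eq[OF sets_rho] by (simp add: space_pair_measure)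

lemma space_rk: "x \<in> space mu \<Longrightarrow> space (rk x) = space mu"
  using sets_eq_imp_space_eq[OF sets_rk] .

lemma rk_finite_AE: "AE x in mu. emeasure (rk x) (space mu) < \<infinity>"
  using c_pos_finite by eventually_elim simp

lemma measure_rk_measurable [measurable]:
  "A \<in> sets mu \<Longrightarrow> (\<lambda>x. measure (rk x) A) \<in> borel_measurable mu"
  unfolding measure_def by (intro measurable_compose[OF rk_measurable]) simp_all

lemma emeasure_rk_eq_measure:
  assumes "x \<in> space mu" "emeasure (rk x) (space mu) < \<infinity>" "A \<in> sets mu"
  shows "emeasure (rk x) A = ennreal (measure (rk x) A)"
proof (rule emeasure_eq_ennreal_measure)
  have "emeasure (rk x) A \<le> emeasure (rk x) (space mu)"
    using assms sets.sets_into_space[of A mu] by (intro emeasure_mono) (auto simp: sets_rk)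
  then show "emeasure (rk x) A \<noteq> top" using assms(2) by (auto simp: top_unique)
qed

lemma emeasure_rho_Times:
  assumes [measurable]: "A \<in> sets mu" "B \<in> sets mu"
  shows "emeasure rho (A \<times> B) = (\<integral>\<^sup>+x\<in>A. emeasure (rk x) B \<partial>mu)"
proof -
  have "emeasure rho (A \<times> B) = (\<integral>\<^sup>+z. indicator (A \<times> B) z \<partial>rho)"
    by (rule nn_integral_indicator[symmetric]) (simp add: sets_rho)
  also have "\<dots> = (\<integral>\<^sup>+x. (\<integral>\<^sup>+y. indicator (A \<times> B) (x, y) \<partial>rk x) \<partial>mu)"
    by (rule disintegration) simp
  also have "\<dots> = (\<integral>\<^sup>+x\<in>A. emeasure (rk x) B \<partial>mu)"
  proof (rule nn_integral_cong)
    fix x assume x: "x \<in> space mu"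
    have "(\<integral>\<^sup>+y. indicator (A \<times> B) (x, y) \<partial>rk x) = (\<integral>\<^sup>+y. indicator A x * indicator B y \<partial>rk x)"
      by (simp add: indicator_times)
    also have "\<dots> = indicator A x * emeasure (rk x) B"
      using x by (simp add: nn_integral_cmult_indicator sets_rk)
    finally show "(\<integral>\<^sup>+y. indicator (A \<times> B) (x, y) \<partial>rk x) = emeasure (rk x) B * indicator A x"
      by (simp add: mult.commute)
  qed
  finally show ?thesis .
qed

text \<open>
  Symmetry is assumed on rectangles only.  It extends to all measurable sets because the strips
  \<open>F i \<times> space mu\<close> over sets \<open>F i\<close> of finite measure exhaust the space and have finite \<open>rho\<close>-measure, by the
  local integrability of the degree.
\<close>

lemma distr_swap_rho: "distr rho (mu \<Otimes>\<^sub>M mu) (\<lambda>(x, y). (y, x)) = rho"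
proof -
  let ?E = "{a \<times> b | a b. a \<in> sets mu \<and> b \<in> sets mu}"
  obtain F :: "nat \<Rightarrow> 'v set" where F: "range F \<subseteq> sets mu" "(\<Union>i. F i) = space mu"
      "\<And>i. emeasure mu (F i) \<noteq> \<infinity>"
    using mu.sigma_finite by metis
  have "rho = distr rho (mu \<Otimes>\<^sub>M mu) (\<lambda>(x, y). (y, x))"
  proof (rule measure_eqI_generator_eq[where E="?E" and \<Omega>="space mu \<times> space mu" and A="\<lambda>i. F i \<times> space mu"])
    show "Int_stable ?E" by (rule Int_stable_pair_measure_generator)
    show "?E \<subseteq> Pow (space mu \<times> space mu)" by (auto dest: sets.sets_into_space)
    show "sets rho = sigma_sets (space mu \<times> space mu) ?E" by (simp add: sets_rho sets_pair_measure)
    show "sets (distr rho (mu \<Otimes>\<^sub>M mu) (\<lambda>(x, y). (y, x))) = sigma_sets (space mu \<times> space mu) ?E"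
      by (simp add: sets_pair_measure)
    show "range (\<lambda>i. F i \<times> space mu) \<subseteq> ?E" using F(1) by auto
    show "(\<Union>i. F i \<times> space mu) = space mu \<times> space mu" using F(2) by blast
    show "emeasure rho (F i \<times> space mu) \<noteq> \<infinity>" for i
    proof -
      have Fi: "F i \<in> sets mu" "emeasure mu (F i) < \<infinity>"
        using F(1) F(3)[of i] by (auto simp: less_top[symmetric])
      show ?thesis using c_locally_integrable[OF Fi] Fi(1) by (simp add: emeasure_rho_Times)
    qed
    fix X assume "X \<in> ?E"
    then obtain A B where X: "X = A \<times> B" and [measurable]: "A \<in> sets mu" "B \<in> sets mu" by auto
    have "(\<lambda>(x, y). (y, x)) -` X \<inter> space rho = B \<times> A"
      using sets.sets_into_space[of A mu] sets.sets_into_space[of B mu] by (auto simp: X space_rho)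
    then show "emeasure rho X = emeasure (distr rho (mu \<Otimes>\<^sub>M mu) (\<lambda>(x, y). (y, x))) X"
      by (subst emeasure_distr) (auto simp: X rho_symmetric intro!: measurable_pair_swap')
  qed
  then show ?thesis by simp
qed

lemma
  fixes F :: "'v \<Rightarrow> 'v \<Rightarrow> 'b::{banach, second_countable_topology}"
  assumes [measurable]: "(\<lambda>z. F (fst z) (snd z)) \<in> borel_measurable (mu \<Otimes>\<^sub>M mu)"
  shows integral_rho_swap: "(\<integral>z. F (snd z) (fst z) \<partial>rho) = (\<integral>z. F (fst z) (snd z) \<partial>rho)"
    and integrable_rho_swap: "integrable rho (\<lambda>z. F (snd z) (fst z)) \<longleftrightarrow> integrable rho (\<lambda>z. F (fst z) (snd z))"
proof -
  have [measurable]: "(\<lambda>(x, y). (y, x)) \<in> measurable rho (mu \<Otimes>\<^sub>M mu)"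
    by measurable
  have "(\<integral>z. F (fst z) (snd z) \<partial>distr rho (mu \<Otimes>\<^sub>M mu) (\<lambda>(x, y). (y, x))) = (\<integral>z. F (snd z) (fst z) \<partial>rho)"
    by (subst integral_distr) (simp_all add: case_prod_beta)
  then show "(\<integral>z. F (snd z) (fst z) \<partial>rho) = (\<integral>z. F (fst z) (snd z) \<partial>rho)"
    by (simp add: distr_swap_rho)
  have "integrable (distr rho (mu \<Otimes>\<^sub>M mu) (\<lambda>(x, y). (y, x))) (\<lambda>z. F (fst z) (snd z)) \<longleftrightarrow>
    integrable rho (\<lambda>z. F (snd z) (fst z))"
    by (subst integrable_distr_eq) (simp_all add: case_prod_beta)
  then show "integrable rho (\<lambda>z. F (snd z) (fst z)) \<longleftrightarrow> integrable rho (\<lambda>z. F (fst z) (snd z))"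
    by (simp add: distr_swap_rho)
qed

text \<open>
  Restricting \<open>rho\<close> to pairs with second coordinate in \<open>B\<close> and forgetting that coordinate leaves the
  density \<open>x \<mapsto> rk x B\<close>.  This carries the disintegration from nonnegative integrands over to the
  vector-valued cylinder functions used below, without any statement about measurability of
  \<open>x \<mapsto> \<integral> F x y d (rk x)\<close>.
\<close>

lemma distr_fst_density_rho:
  assumes B [measurable]: "B \<in> sets mu"
  shows "distr (density rho (\<lambda>z. ennreal (indicator B (snd z)))) mu fst
    = density mu (\<lambda>x. ennreal (measure (rk x) B))"
proof (rule measure_eqI)
  fix A assume "A \<in> sets (distr (density rho (\<lambda>z. ennreal (indicator B (snd z)))) mu fst)"
  then have A [measurable]: "A \<in> sets mu" by simp
  have "fst -` A \<inter> space rho = A \<times> space mu"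
    using sets.sets_into_space[OF A] by (auto simp: space_rho)
  then have "emeasure (distr (density rho (\<lambda>z. ennreal (indicator B (snd z)))) mu fst) A
    = (\<integral>\<^sup>+z. ennreal (indicator B (snd z)) * indicator (A \<times> space mu) z \<partial>rho)"
    by (simp add: emeasure_distr emeasure_density)
  also have "\<dots> = (\<integral>\<^sup>+z. indicator (A \<times> B) z \<partial>rho)"
    using sets.sets_into_space[OF B] by (intro nn_integral_cong) (auto simp: indicator_def)
  also have "\<dots> = emeasure rho (A \<times> B)"
    by (rule nn_integral_indicator) (simp add: sets_rho)
  also have "\<dots> = (\<integral>\<^sup>+x. emeasure (rk x) B * indicator A x \<partial>mu)"
    by (simp add: emeasure_rho_Times)
  also have "\<dots> = (\<integral>\<^sup>+x. ennreal (measure (rk x) B) * indicator A x \<partial>mu)"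
  proof (rule nn_integral_cong_AE)
    show "AE x in mu. emeasure (rk x) B * indicator A x = ennreal (measure (rk x) B) * indicator A x"
      using rk_finite_AE AE_space by eventually_elim (simp only: emeasure_rk_eq_measure[OF _ _ B])
  qed
  also have "\<dots> = emeasure (density mu (\<lambda>x. ennreal (measure (rk x) B))) A"
    by (simp add: emeasure_density)
  finally show "emeasure (distr (density rho (\<lambda>z. ennreal (indicator B (snd z)))) mu fst) A
    = emeasure (density mu (\<lambda>x. ennreal (measure (rk x) B))) A" .
qed simp

lemma
  fixes g :: "'v \<Rightarrow> 'b::{banach, second_countable_topology}"
  assumes [measurable]: "B \<in> sets mu" "g \<in> borel_measurable mu"
  shows integral_rho_cylinder:
      "(\<integral>z. indicator B (snd z) *\<^sub>R g (fst z) \<partial>rho) = (\<integral>x. measure (rk x) B *\<^sub>R g x \<partial>mu)"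
    and integrable_rho_cylinder:
      "integrable rho (\<lambda>z. indicator B (snd z) *\<^sub>R g (fst z)) \<longleftrightarrow> integrable mu (\<lambda>x. measure (rk x) B *\<^sub>R g x)"
proof -
  let ?D = "density rho (\<lambda>z. ennreal (indicator B (snd z)))"
  have "(\<integral>z. indicator B (snd z) *\<^sub>R g (fst z) \<partial>rho) = (\<integral>z. g (fst z) \<partial>?D)"
    by (subst integral_density) simp_all
  also have "\<dots> = (\<integral>x. g x \<partial>distr ?D mu fst)"
    by (subst integral_distr) simp_all
  also have "\<dots> = (\<integral>x. measure (rk x) B *\<^sub>R g x \<partial>mu)"
    by (simp add: distr_fst_density_rho integral_density)
  finally show "(\<integral>z. indicator B (snd z) *\<^sub>R g (fst z) \<partial>rho) = (\<integral>x. measure (rk x) B *\<^sub>R g x \<partial>mu)" .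
  have "integrable rho (\<lambda>z. indicator B (snd z) *\<^sub>R g (fst z)) \<longleftrightarrow> integrable ?D (\<lambda>z. g (fst z))"
    by (subst integrable_density) simp_all
  also have "\<dots> \<longleftrightarrow> integrable (distr ?D mu fst) g"
    by (subst integrable_distr_eq) simp_all
  also have "\<dots> \<longleftrightarrow> integrable mu (\<lambda>x. measure (rk x) B *\<^sub>R g x)"
    by (simp add: distr_fst_density_rho integrable_density)
  finally show "integrable rho (\<lambda>z. indicator B (snd z) *\<^sub>R g (fst z)) \<longleftrightarrow> integrable mu (\<lambda>x. measure (rk x) B *\<^sub>R g x)" .
qed

end

section \<open>The graph Laplace operator\<close>

text \<open>
  Beyond placing the operator in \<open>L2\<close>, the assumption \<open>laplace_L2\<close> bounds the degree: it makes
  \<open>x \<mapsto> rk x (space mu)\<close> square-integrable on sets of finite measure (\<open>degree_indicator_L2\<close>).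
\<close>

locale square_integrable_graph = symmetric_measure_graph mu rho rk E
  for mu :: "'v measure" and rho :: "('v \<times> 'v) measure"
    and rk :: "'v \<Rightarrow> 'v measure" and E :: "('v \<times> 'v) set" +
  assumes measure_rk_L2: "\<And>A. A \<in> sets mu \<Longrightarrow> emeasure mu A < \<infinity> \<Longrightarrow>
        (\<lambda>x. complex_of_real (measure (rk x) A)) \<in> L2 mu"
    and laplace_L2: "\<And>f. f \<in> D_fin mu \<Longrightarrow> graph_laplace rk f \<in> L2 mu"
begin

lemma D_fin_L2: "f \<in> D_fin mu \<Longrightarrow> f \<in> L2 mu"
  using D_fin_subset_L2 by blast

lemma D_fin_measurable: "f \<in> D_fin mu \<Longrightarrow> f \<in> borel_measurable mu"
  using D_fin_L2 by (simp add: L2_def)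

lemma cmod_indicator: "cmod (indicator A x) = indicator A x"
  by (simp add: indicator_def)

lemma finite_measure_rk:
  assumes "x \<in> space mu" "emeasure (rk x) (space mu) < \<infinity>"
  shows "finite_measure (rk x)"
  using assms by (intro finite_measureI) (simp add: space_rk)

lemma integrable_rk_indicator:
  assumes "x \<in> space mu" "emeasure (rk x) (space mu) < \<infinity>" "A \<in> sets mu"
  shows "integrable (rk x) (indicator A :: 'v \<Rightarrow> complex)"
proof -
  interpret finite_measure "rk x" using finite_measure_rk[OF assms(1,2)] .
  have "A \<in> sets (rk x)" using assms by (simp add: sets_rk)
  then show ?thesis
    by (intro integrable_const_bound[where B=1]) (auto simp: indicator_def)
qed

lemma integrable_rk_D_fin:
  assumes x: "x \<in> space mu" "emeasure (rk x) (space mu) < \<infinity>" and f: "f \<in> D_fin mu"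
  shows "integrable (rk x) f"
  using f
proof (induction rule: D_fin_induct)
  case (step g a A)
  then show ?case by (intro Bochner_Integration.integrable_add integrable_mult_right)
      (auto intro: integrable_rk_indicator x)
qed simp

lemma graph_laplace_lincomb:
  assumes f: "f \<in> D_fin mu" and g: "g \<in> D_fin mu"
  shows "AE x in mu. graph_laplace rk (\<lambda>x. f x + a * g x) x = graph_laplace rk f x + a * graph_laplace rk g x"
  using rk_finite_AE AE_space
proof eventually_elim
  case (elim x)
  interpret finite_measure "rk x" using finite_measure_rk[OF elim(2,1)] .
  have i: "integrable (rk x) (\<lambda>y. h x - h y)" if "h \<in> D_fin mu" for h
    using integrable_rk_D_fin[OF elim(2,1) that] by simp
  have "graph_laplace rk (\<lambda>x. f x + a * g x) x = (\<integral>y. (f x - f y) + a * (g x - g y) \<partial>rk x)"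
    unfolding graph_laplace_def by (simp add: algebra_simps)
  also have "\<dots> = graph_laplace rk f x + a * graph_laplace rk g x"
    unfolding graph_laplace_def
    by (subst Bochner_Integration.integral_add) (use i[OF f] i[OF g] in simp_all)
  finally show ?case .
qed

lemma graph_laplace_indicator:
  assumes A: "A \<in> sets mu"
  shows "AE x in mu. graph_laplace rk (indicator A) x
    = complex_of_real (measure (rk x) (space mu)) * indicator A x - complex_of_real (measure (rk x) A)"
  using rk_finite_AE AE_space
proof eventually_elim
  case (elim x)
  interpret finite_measure "rk x" using finite_measure_rk[OF elim(2,1)] .
  have Ax: "A \<inter> space (rk x) = A"
    using sets.sets_into_space[OF A] elim by (auto simp: space_rk)
  have "graph_laplace rk (indicator A) x = (\<integral>y. indicator A x \<partial>rk x) - (\<integral>y. indicator A y \<partial>rk x)"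
    unfolding graph_laplace_def
    using integrable_rk_indicator[OF elim(2,1) A] by (intro Bochner_Integration.integral_diff) simp_all
  also have "(\<integral>y. indicator A y \<partial>rk x) = complex_of_real (measure (rk x) A)"
  proof -
    have "(\<integral>y. indicator A y \<partial>rk x) = (\<integral>y. complex_of_real (indicator A y) \<partial>rk x)"
      by (intro Bochner_Integration.integral_cong) (auto simp: indicator_def)
    also have "\<dots> = complex_of_real (\<integral>y. indicator A y \<partial>rk x)" by (rule integral_complex_of_real)
    also have "(\<integral>y. indicator A y \<partial>rk x) = measure (rk x) A"
      unfolding Bochner_Integration.integral_indicator Ax ..
    finally show ?thesis .
  qed
  finally show ?case by (simp add: space_rk elim scaleR_conv_of_real)
qed

text \<open>
  On an indicator the Laplace operator takes the value \<open>c x * indicator A x - rk x A\<close> with \<open>c x = rk x (space mu)\<close>; this function and its second term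
  are square-integrable, hence so is the first.
\<close>

lemma degree_indicator_L2:
  assumes A: "A \<in> sets mu" "emeasure mu A < \<infinity>"
  shows "(\<lambda>x. complex_of_real (measure (rk x) (space mu)) * indicator A x) \<in> L2 mu"
proof (rule L2_cong_AE)
  show "(\<lambda>x. graph_laplace rk (indicator A) x + complex_of_real (measure (rk x) A)) \<in> L2 mu"
    by (intro L2_add laplace_L2 measure_rk_L2 D_fin_indicator A)
  show "(\<lambda>x. complex_of_real (measure (rk x) (space mu)) * indicator A x) \<in> borel_measurable mu"
    using A(1) by measurable
  show "AE x in mu. graph_laplace rk (indicator A) x + complex_of_real (measure (rk x) A)
    = complex_of_real (measure (rk x) (space mu)) * indicator A x"
    using graph_laplace_indicator[OF A(1)] by eventually_elim simp
qed

lemma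
  assumes A: "A \<in> sets mu" "emeasure mu A < \<infinity>" and f: "f \<in> L2 mu"
  shows integrable_indicator_fst: "integrable rho (\<lambda>z. indicator A (fst z) * cnj (f (fst z)))"
    and integrable_indicator_snd: "integrable rho (\<lambda>z. indicator A (snd z) * cnj (f (fst z)))"
    and integral_indicator_fst: "(\<integral>z. indicator A (fst z) * cnj (f (fst z)) \<partial>rho)
      = (\<integral>x. complex_of_real (measure (rk x) (space mu)) * indicator A x * cnj (f x) \<partial>mu)"
    and integral_indicator_snd: "(\<integral>z. indicator A (snd z) * cnj (f (fst z)) \<partial>rho)
      = (\<integral>x. complex_of_real (measure (rk x) A) * cnj (f x) \<partial>mu)"
proof -
  have [measurable]: "A \<in> sets mu" "f \<in> borel_measurable mu" using A f by (auto simp: L2_def)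
  let ?g = "\<lambda>x. indicator A x * cnj (f x)"
  (* Written as a cylinder over the whole space, the first integrand is paired with the degree. *)
  have fst_eq: "indicator A (fst z) * cnj (f (fst z)) = indicator (space mu) (snd z) *\<^sub>R ?g (fst z)"
    if "z \<in> space rho" for z using that by (auto simp: space_rho indicator_def)
  have snd_eq: "indicator A (snd z) * cnj (f (fst z)) = indicator A (snd z) *\<^sub>R cnj (f (fst z))" for z
    by (auto simp: indicator_def)
  have g: "?g \<in> borel_measurable mu" and f': "(\<lambda>x. cnj (f x)) \<in> borel_measurable mu" by measurable
  have "integrable mu (\<lambda>x. complex_of_real (measure (rk x) (space mu)) * indicator A x * cnj (f x))"
    by (rule L2_integrable_mult[OF degree_indicator_L2[OF A] f])
  then have "integrable mu (\<lambda>x. measure (rk x) (space mu) *\<^sub>R ?g x)"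
    by (simp add: scaleR_conv_of_real mult.assoc)
  then have "integrable rho (\<lambda>z. indicator (space mu) (snd z) *\<^sub>R ?g (fst z))"
    using integrable_rho_cylinder[OF sets.top g] by blast
  then show "integrable rho (\<lambda>z. indicator A (fst z) * cnj (f (fst z)))"
    by (subst Bochner_Integration.integrable_cong[OF refl fst_eq])
  have "(\<integral>z. indicator A (fst z) * cnj (f (fst z)) \<partial>rho) = (\<integral>z. indicator (space mu) (snd z) *\<^sub>R ?g (fst z) \<partial>rho)"
    by (rule Bochner_Integration.integral_cong[OF refl fst_eq])
  also have "\<dots> = (\<integral>x. measure (rk x) (space mu) *\<^sub>R ?g x \<partial>mu)"
    by (rule integral_rho_cylinder[OF sets.top g])
  finally show "(\<integral>z. indicator A (fst z) * cnj (f (fst z)) \<partial>rho)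
      = (\<integral>x. complex_of_real (measure (rk x) (space mu)) * indicator A x * cnj (f x) \<partial>mu)"
    by (simp add: scaleR_conv_of_real mult.assoc)
  have "integrable mu (\<lambda>x. complex_of_real (measure (rk x) A) * cnj (f x))"
    by (rule L2_integrable_mult[OF measure_rk_L2[OF A] f])
  then have "integrable mu (\<lambda>x. measure (rk x) A *\<^sub>R cnj (f x))"
    by (simp add: scaleR_conv_of_real)
  then show "integrable rho (\<lambda>z. indicator A (snd z) * cnj (f (fst z)))"
    unfolding snd_eq using integrable_rho_cylinder[OF A(1) f'] by blast
  show "(\<integral>z. indicator A (snd z) * cnj (f (fst z)) \<partial>rho)
      = (\<integral>x. complex_of_real (measure (rk x) A) * cnj (f x) \<partial>mu)"
    unfolding snd_eq by (subst integral_rho_cylinder[OF A(1) f']) (simp add: scaleR_conv_of_real)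
qed

text \<open>
  On a single indicator both sides are computed from the two cylinder integrals above; linearity in \<open>h\<close>
  does the rest.
\<close>

lemma Green_formula:
  assumes h: "h \<in> D_fin mu" and f: "f \<in> L2 mu"
  shows "integrable rho (\<lambda>z. (h (fst z) - h (snd z)) * cnj (f (fst z))) \<and>
    l2_inner mu (graph_laplace rk h) f = (\<integral>z. (h (fst z) - h (snd z)) * cnj (f (fst z)) \<partial>rho)"
  using h
proof (induction rule: D_fin_induct)
  case zero
  show ?case by (simp add: graph_laplace_def[abs_def])
next
  case (step h a A)
  note A = step.hyps(2,3)
  let ?I = "indicator A :: 'v \<Rightarrow> complex"
  note i1 = integrable_indicator_fst[OF A f] and i2 = integrable_indicator_snd[OF A f]
  have eq: "(h (fst z) + a * ?I (fst z) - (h (snd z) + a * ?I (snd z))) * cnj (f (fst z))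
    = (h (fst z) - h (snd z)) * cnj (f (fst z))
      + a * (?I (fst z) * cnj (f (fst z)) - ?I (snd z) * cnj (f (fst z)))" for z
    by (simp add: algebra_simps)
  have L: "graph_laplace rk h \<in> L2 mu" "graph_laplace rk ?I \<in> L2 mu"
    by (intro laplace_L2 D_fin_indicator step.hyps)+
  have c: "(\<lambda>x. complex_of_real (measure (rk x) (space mu)) * ?I x) \<in> L2 mu"
    "(\<lambda>x. complex_of_real (measure (rk x) A)) \<in> L2 mu"
    using degree_indicator_L2[OF A] measure_rk_L2[OF A] .
  have "l2_inner mu (graph_laplace rk ?I) f
    = l2_inner mu (\<lambda>x. complex_of_real (measure (rk x) (space mu)) * ?I x - complex_of_real (measure (rk x) A)) f"
    by (rule l2_inner_cong_AE[OF L2_measurable[OF L(2)] L2_measurable[OF L2_diff[OF c]] L2_measurable[OF f] L2_measurable[OF f]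
          graph_laplace_indicator[OF A(1)] AE_I2[OF refl]])
  also have "\<dots> = (\<integral>z. ?I (fst z) * cnj (f (fst z)) \<partial>rho) - (\<integral>z. ?I (snd z) * cnj (f (fst z)) \<partial>rho)"
    unfolding l2_inner_diff_left[OF c f] integral_indicator_fst[OF A f] integral_indicator_snd[OF A f]
    by (simp add: l2_inner_def)
  finally have I: "l2_inner mu (graph_laplace rk ?I) f
    = (\<integral>z. ?I (fst z) * cnj (f (fst z)) - ?I (snd z) * cnj (f (fst z)) \<partial>rho)"
    using i1 i2 by simp
  have "l2_inner mu (graph_laplace rk (\<lambda>x. h x + a * ?I x)) f
    = l2_inner mu (\<lambda>x. graph_laplace rk h x + a * graph_laplace rk ?I x) f"
    using step.hyps
    by (intro l2_inner_cong_AE L2_measurable[OF laplace_L2] L2_measurable[OF L2_add] L2_measurable[OF f]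
        D_fin_lincomb D_fin_indicator L L2_scale graph_laplace_lincomb AE_I2 refl)
  also have "\<dots> = l2_inner mu (graph_laplace rk h) f + a * l2_inner mu (graph_laplace rk ?I) f"
    using L f by (simp add: l2_inner_add_left L2_scale l2_inner_scale_left)
  finally show ?case
    unfolding eq using step.IH i1 i2 by (simp add: I)
qed

text \<open>
  By exchanging the coordinates, both sides equal
  \<open>1/2 * \<integral> (f x - f y) * cnj (g x - g y) d rho\<close>.
\<close>

lemma Dirichlet_form_Hermitian:
  assumes f: "f \<in> D_fin mu" and g: "g \<in> D_fin mu"
  shows "l2_inner mu (graph_laplace rk f) g = l2_inner mu f (graph_laplace rk g)"
proof -
  have [measurable]: "f \<in> borel_measurable mu" "g \<in> borel_measurable mu"
    using f g by (auto intro: D_fin_measurable)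
  let ?F = "\<lambda>x y. (f x - f y) * cnj (g x)" and ?G = "\<lambda>x y. cnj (g x - g y) * f x"
  have mF: "(\<lambda>z. ?F (fst z) (snd z)) \<in> borel_measurable (mu \<Otimes>\<^sub>M mu)"
    and mG: "(\<lambda>z. ?G (fst z) (snd z)) \<in> borel_measurable (mu \<Otimes>\<^sub>M mu)" by measurable
  have F: "integrable rho (\<lambda>z. ?F (fst z) (snd z))"
    "l2_inner mu (graph_laplace rk f) g = (\<integral>z. ?F (fst z) (snd z) \<partial>rho)"
    using Green_formula[OF f D_fin_L2[OF g]] by auto
  have G': "integrable rho (\<lambda>z. (g (fst z) - g (snd z)) * cnj (f (fst z)))"
    "l2_inner mu (graph_laplace rk g) f = (\<integral>z. (g (fst z) - g (snd z)) * cnj (f (fst z)) \<partial>rho)"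
    using Green_formula[OF g D_fin_L2[OF f]] by auto
  have Gc: "?G x y = cnj ((g x - g y) * cnj (f x))" for x y by simp
  have G: "integrable rho (\<lambda>z. ?G (fst z) (snd z))"
    unfolding Gc using G'(1) by (rule integrable_cnj)
  have G2: "l2_inner mu f (graph_laplace rk g) = (\<integral>z. ?G (fst z) (snd z) \<partial>rho)"
    unfolding Gc l2_inner_commute[of mu f] G'(2) by (rule Bochner_Integration.integral_cnj[symmetric])
  have "2 * (\<integral>z. ?F (fst z) (snd z) \<partial>rho) = (\<integral>z. ?F (fst z) (snd z) + ?F (snd z) (fst z) \<partial>rho)"
    using F(1) integrable_rho_swap[OF mF] integral_rho_swap[OF mF] by simp
  also have "\<dots> = (\<integral>z. ?G (fst z) (snd z) + ?G (snd z) (fst z) \<partial>rho)"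
    by (intro Bochner_Integration.integral_cong refl) (simp add: algebra_simps)
  also have "\<dots> = 2 * (\<integral>z. ?G (fst z) (snd z) \<partial>rho)"
    using G integrable_rho_swap[OF mG] integral_rho_swap[OF mG] by simp
  finally show ?thesis using F(2) G2 by simp
qed

lemma laplace_operatorE:
  assumes "(f, g) \<in> laplace_operator mu rk"
  obtains h where "h \<in> D_fin mu" "f \<in> L2 mu" "g \<in> L2 mu" "AE x in mu. f x = h x"
    "AE x in mu. g x = graph_laplace rk h x"
  using assms unfolding laplace_operator_def by auto

lemma laplace_operatorI:
  "h \<in> D_fin mu \<Longrightarrow> f \<in> L2 mu \<Longrightarrow> g \<in> L2 mu \<Longrightarrow> AE x in mu. f x = h x \<Longrightarrow>
    AE x in mu. g x = graph_laplace rk h x \<Longrightarrow> (f, g) \<in> laplace_operator mu rk"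
  unfolding laplace_operator_def by auto

lemma D_fin_in_laplace_operator:
  "h \<in> D_fin mu \<Longrightarrow> (h, graph_laplace rk h) \<in> laplace_operator mu rk"
  by (rule laplace_operatorI) (auto intro: D_fin_L2 laplace_L2)

lemma laplace_operator_Hermitian:
  assumes 1: "(f, g) \<in> laplace_operator mu rk" and 2: "(h, k) \<in> laplace_operator mu rk"
  shows "l2_inner mu g h = l2_inner mu f k"
proof -
  obtain p where p: "p \<in> D_fin mu" "f \<in> L2 mu" "g \<in> L2 mu" "AE x in mu. f x = p x"
    "AE x in mu. g x = graph_laplace rk p x" using 1 by (rule laplace_operatorE)
  obtain q where q: "q \<in> D_fin mu" "h \<in> L2 mu" "k \<in> L2 mu" "AE x in mu. h x = q x"
    "AE x in mu. k x = graph_laplace rk q x" using 2 by (rule laplace_operatorE)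
  have "l2_inner mu g h = l2_inner mu (graph_laplace rk p) q"
    by (intro l2_inner_cong_AE L2_measurable p q D_fin_L2 laplace_L2)
  also have "\<dots> = l2_inner mu p (graph_laplace rk q)"
    by (rule Dirichlet_form_Hermitian[OF p(1) q(1)])
  also have "\<dots> = l2_inner mu f k"
    by (rule sym, intro l2_inner_cong_AE L2_measurable p q D_fin_L2 laplace_L2)
  finally show ?thesis .
qed

text \<open>
  That the values of the operator do not depend on the representative in \<open>D_fin\<close> is a consequence of
  symmetry: if \<open>f\<close> and \<open>f'\<close> agree almost everywhere, the difference of the images is orthogonal to
  the dense domain.
\<close>

lemma symmetric_laplace_operator: "symmetric_operator mu (laplace_operator mu rk)"
proof -
  let ?T = "laplace_operator mu rk"
  have sub: "?T \<subseteq> L2 mu \<times> L2 mu" by (auto elim: laplace_operatorE)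
  have dense: "densely_defined mu ?T"
    unfolding densely_defined_def
  proof (intro ballI allI impI)
    fix f :: "'v \<Rightarrow> complex" and e :: real assume "f \<in> L2 mu" "0 < e"
    then obtain h where "h \<in> D_fin mu" "l2_dist mu f h < e" using D_fin_dense by blast
    then show "\<exists>h\<in>Domain ?T. l2_dist mu f h < e" using D_fin_in_laplace_operator by blast
  qed
  have lincomb: "((\<lambda>x. f x + a * f' x), (\<lambda>x. g x + a * g' x)) \<in> ?T"
    if 1: "(f, g) \<in> ?T" and 2: "(f', g') \<in> ?T" for f g f' g' a
  proof -
    obtain p where p: "p \<in> D_fin mu" "f \<in> L2 mu" "g \<in> L2 mu" "AE x in mu. f x = p x"
      "AE x in mu. g x = graph_laplace rk p x" using 1 by (rule laplace_operatorE)
    obtain q where q: "q \<in> D_fin mu" "f' \<in> L2 mu" "g' \<in> L2 mu" "AE x in mu. f' x = q x"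
      "AE x in mu. g' x = graph_laplace rk q x" using 2 by (rule laplace_operatorE)
    show ?thesis
    proof (rule laplace_operatorI[OF D_fin_lincomb[OF p(1) q(1), of a]])
      show "AE x in mu. f x + a * f' x = p x + a * q x" using p(4) q(4) by eventually_elim simp
      show "AE x in mu. g x + a * g' x = graph_laplace rk (\<lambda>x. p x + a * q x) x"
        using p(5) q(5) graph_laplace_lincomb[OF p(1) q(1), of a] by eventually_elim simp
    qed (intro L2_add L2_scale p q)+
  qed
  have zero: "((\<lambda>x. 0), (\<lambda>x. 0)) \<in> ?T"
    using D_fin_in_laplace_operator[OF D_fin_zero] by (simp add: graph_laplace_def[abs_def])
  have cong: "(f', g') \<in> ?T" if 1: "(f, g) \<in> ?T" and L: "f' \<in> L2 mu" "g' \<in> L2 mu"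
    and eq: "AE x in mu. f x = f' x" "AE x in mu. g x = g' x" for f g f' g'
  proof -
    obtain p where p: "p \<in> D_fin mu" "f \<in> L2 mu" "g \<in> L2 mu" "AE x in mu. f x = p x"
      "AE x in mu. g x = graph_laplace rk p x" using 1 by (rule laplace_operatorE)
    show ?thesis
    proof (rule laplace_operatorI[OF p(1) L])
      show "AE x in mu. f' x = p x" using p(4) eq(1) by eventually_elim simp
      show "AE x in mu. g' x = graph_laplace rk p x" using p(5) eq(2) by eventually_elim simp
    qed
  qed
  have unique: "AE x in mu. g x = g' x"
    if 1: "(f, g) \<in> ?T" and 2: "(f', g') \<in> ?T" and eq: "AE x in mu. f x = f' x" for f g f' g'
  proof -
    have L: "f \<in> L2 mu" "g \<in> L2 mu" "f' \<in> L2 mu" "g' \<in> L2 mu" using sub 1 2 by auto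
    have "AE x in mu. g x - g' x = 0"
    proof (rule densely_defined_orthogonal_imp_zero[OF sub dense L2_diff[OF L(2,4)]])
      fix h k assume hk: "(h, k) \<in> ?T"
      then have L': "h \<in> L2 mu" "k \<in> L2 mu" using sub by auto
      have "l2_inner mu h g = l2_inner mu k f" "l2_inner mu h g' = l2_inner mu k f'"
        using laplace_operator_Hermitian[OF hk 1] laplace_operator_Hermitian[OF hk 2] by simp_all
      moreover have "l2_inner mu k f = l2_inner mu k f'"
        by (rule l2_inner_cong_AE[OF _ _ _ _ _ eq]) (auto intro: L L' L2_measurable)
      ultimately show "l2_inner mu h (\<lambda>x. g x - g' x) = 0"
        using L L' by (simp add: l2_inner_diff_right)
    qed
    then show ?thesis by eventually_elim simp
  qed
  have "linear_operator mu ?T"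
    unfolding linear_operator_def
  proof (intro conjI allI impI)
    show "((\<lambda>x. f x + f' x), (\<lambda>x. g x + g' x)) \<in> ?T" if "(f, g) \<in> ?T" "(f', g') \<in> ?T" for f g f' g'
      using lincomb[OF that, of 1] by simp
    show "((\<lambda>x. a * f x), (\<lambda>x. a * g x)) \<in> ?T" if "(f, g) \<in> ?T" for f g a
      using lincomb[OF zero that, of a] by simp
  qed (fact sub, fact zero, (erule (4) cong), (erule (2) unique))
  then show ?thesis
    unfolding symmetric_operator_def using dense laplace_operator_Hermitian by auto
qed

text \<open>
  The rearrangement inequality for the two numbers \<open>\<bar>f x\<bar>\<close> and \<open>\<bar>f y\<bar>\<close> and a nondecreasing function of
  them, here the indicator of a level set, integrated against a measure that does not distinguish
  \<open>x\<close> from \<open>y\<close>.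
\<close>

lemma integral_level_set_swap_le:
  assumes f: "f \<in> L2 mu" and e: "0 < e"
  defines "A \<equiv> {x\<in>space mu. e \<le> cmod (f x)}"
  shows "(\<integral>z. indicator A (snd z) * cmod (f (fst z)) \<partial>rho) \<le> (\<integral>z. indicator A (fst z) * cmod (f (fst z)) \<partial>rho)"
proof -
  have [measurable]: "f \<in> borel_measurable mu" using f by (simp add: L2_def)
  have A: "A \<in> sets mu" "emeasure mu A < \<infinity>"
    using L2_level_set_finite[OF f e] by (auto simp: A_def)
  have [measurable]: "A \<in> sets mu" by (rule A(1))
  let ?S = "\<lambda>x y. indicator A y * cmod (f x)" and ?D = "\<lambda>x y::'v. indicator A x * cmod (f x)"
  have mS: "(\<lambda>z. ?S (fst z) (snd z)) \<in> borel_measurable (mu \<Otimes>\<^sub>M mu)"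
    and mD: "(\<lambda>z. ?D (fst z) (snd z)) \<in> borel_measurable (mu \<Otimes>\<^sub>M mu)" by measurable
  have iS: "integrable rho (\<lambda>z. ?S (fst z) (snd z))"
    using integrable_norm[OF integrable_indicator_snd[OF A f]] by (simp add: norm_mult cmod_indicator)
  have iD: "integrable rho (\<lambda>z. ?D (fst z) (snd z))"
    using integrable_norm[OF integrable_indicator_fst[OF A f]] by (simp add: norm_mult cmod_indicator)
  have "2 * (\<integral>z. ?S (fst z) (snd z) \<partial>rho) = (\<integral>z. ?S (fst z) (snd z) + ?S (snd z) (fst z) \<partial>rho)"
    using iS integrable_rho_swap[OF mS] integral_rho_swap[OF mS] by simp
  also have "\<dots> \<le> (\<integral>z. ?D (fst z) (snd z) + ?D (snd z) (fst z) \<partial>rho)"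
  proof (rule integral_mono)
    show "integrable rho (\<lambda>z. ?S (fst z) (snd z) + ?S (snd z) (fst z))"
      using iS integrable_rho_swap[OF mS] by simp
    show "integrable rho (\<lambda>z. ?D (fst z) (snd z) + ?D (snd z) (fst z))"
      using iD integrable_rho_swap[OF mD] by simp
    fix z assume "z \<in> space rho"
    then show "?S (fst z) (snd z) + ?S (snd z) (fst z) \<le> ?D (fst z) (snd z) + ?D (snd z) (fst z)"
      by (auto simp: A_def indicator_def space_rho)
  qed
  also have "\<dots> = 2 * (\<integral>z. ?D (fst z) (snd z) \<partial>rho)"
    using iD integrable_rho_swap[OF mD] integral_rho_swap[OF mD] by simp
  finally show ?thesis by simp
qed

text \<open>
  The test function \<open>u = indicator A * f / \<bar>f\<bar>\<close> need not be in \<open>D_fin\<close>, so the equation for it is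
  obtained as a limit along \<open>D_fin\<close>; all integrands are dominated because \<open>A\<close> has finite
  measure.
\<close>

lemma adjoint_eigenfunction_zero:
  assumes fl: "(f, \<lambda>x. l * f x) \<in> adjoint_operator mu (laplace_operator mu rk)"
    and l: "Re l = 0" "l \<noteq> 0"
  shows "AE x in mu. f x = 0"
proof -
  have f: "f \<in> L2 mu" by (rule adjoint_operatorD(1)[OF fl])
  have [measurable]: "f \<in> borel_measurable mu" using f by (simp add: L2_def)
  have weak: "(\<integral>z. (h (fst z) - h (snd z)) * cnj (f (fst z)) \<partial>rho) = cnj l * (\<integral>x. h x * cnj (f x) \<partial>mu)"
    if h: "h \<in> D_fin mu" for h
    using adjoint_operatorD(3)[OF fl D_fin_in_laplace_operator[OF h]] Green_formula[OF h f]
    by (simp only: l2_inner_scale_right) (simp add: l2_inner_def)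
  have level: "AE x in mu. \<not> e \<le> cmod (f x)" if e: "0 < e" for e
  proof -
    define A where "A = {x\<in>space mu. e \<le> cmod (f x)}"
    have A: "A \<in> sets mu" "emeasure mu A < \<infinity>"
      using L2_level_set_finite[OF f e] by (auto simp: A_def)
    have [measurable]: "A \<in> sets mu" by (rule A(1))
    define u where "u x = indicator A x * (f x / complex_of_real (cmod (f x)))" for x
    have u_le: "cmod (u x) \<le> indicator A x" for x
      by (auto simp: u_def indicator_def norm_divide)
    have u_f: "u x * cnj (f x) = complex_of_real (indicator A x * cmod (f x))" for x
    proof (cases "f x = 0")
      case False
      have "f x * cnj (f x) = complex_of_real (cmod (f x)) * complex_of_real (cmod (f x))"
        by (simp add: complex_norm_square[symmetric] power2_eq_square)
      with False show ?thesis by (simp add: u_def indicator_def)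
    qed (simp add: u_def)
    have u: "u \<in> L2 mu"
    proof (rule L2_dominated[OF D_fin_L2[OF D_fin_indicator[OF A]], of _ 1])
      show "u \<in> borel_measurable mu" unfolding u_def[abs_def] by measurable
      show "AE x in mu. cmod (u x) \<le> 1 * cmod (indicator A x)"
        using u_le by (auto simp: cmod_indicator)
    qed
    have [measurable]: "u \<in> borel_measurable mu" using u by (simp add: L2_def)
    obtain F where F: "\<And>n::nat. F n \<in> D_fin mu" "\<And>x. x \<in> space mu \<Longrightarrow> (\<lambda>n. F n x) \<longlonglongrightarrow> u x"
      "\<And>n x. x \<in> space mu \<Longrightarrow> cmod (F n x) \<le> 2 * cmod (u x)"
      using L2_approx_D_fin[OF u] by metis
    have [measurable]: "F n \<in> borel_measurable mu" for n by (rule D_fin_measurable[OF F(1)])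
    have F_le: "cmod (F n x) \<le> 2 * indicator A x" if "x \<in> space mu" for n x
      using F(3)[OF that, of n] u_le[of x] by linarith
    have iD: "integrable rho (\<lambda>z. indicator A (fst z) * cmod (f (fst z)))"
      using integrable_norm[OF integrable_indicator_fst[OF A f]] by (simp add: norm_mult cmod_indicator)
    have iS: "integrable rho (\<lambda>z. indicator A (snd z) * cmod (f (fst z)))"
      using integrable_norm[OF integrable_indicator_snd[OF A f]] by (simp add: norm_mult cmod_indicator)
    have im: "integrable mu (\<lambda>x. indicator A x * cmod (f x))"
      using integrable_norm[OF L2_integrable_mult[OF D_fin_L2[OF D_fin_indicator[OF A]] f]]
      by (simp add: norm_mult cmod_indicator)
    have lim_rho: "(\<lambda>n. \<integral>z. (F n (fst z) - F n (snd z)) * cnj (f (fst z)) \<partial>rho)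
      \<longlonglongrightarrow> (\<integral>z. (u (fst z) - u (snd z)) * cnj (f (fst z)) \<partial>rho)"
    proof (rule integral_dominated_convergence)
      show "integrable rho (\<lambda>z. 2 * (indicator A (fst z) * cmod (f (fst z))) + 2 * (indicator A (snd z) * cmod (f (fst z))))"
        using iD iS by simp
      show "AE z in rho. (\<lambda>n. (F n (fst z) - F n (snd z)) * cnj (f (fst z)))
          \<longlonglongrightarrow> (u (fst z) - u (snd z)) * cnj (f (fst z))"
      proof (rule AE_I2)
        fix z assume "z \<in> space rho"
        then have "fst z \<in> space mu" "snd z \<in> space mu" by (auto simp: space_rho)
        then show "(\<lambda>n. (F n (fst z) - F n (snd z)) * cnj (f (fst z)))
          \<longlonglongrightarrow> (u (fst z) - u (snd z)) * cnj (f (fst z))"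
          by (intro tendsto_mult tendsto_diff tendsto_const F(2))
      qed
      show "AE z in rho. norm ((F n (fst z) - F n (snd z)) * cnj (f (fst z)))
        \<le> 2 * (indicator A (fst z) * cmod (f (fst z))) + 2 * (indicator A (snd z) * cmod (f (fst z)))" for n
      proof (rule AE_I2)
        fix z assume "z \<in> space rho"
        then have z: "fst z \<in> space mu" "snd z \<in> space mu" by (auto simp: space_rho)
        have "cmod (F n (fst z) - F n (snd z)) \<le> cmod (F n (fst z)) + cmod (F n (snd z))"
          by (rule norm_triangle_ineq4)
        also have "\<dots> \<le> 2 * indicator A (fst z) + 2 * indicator A (snd z)"
          by (intro add_mono F_le z)
        finally have "cmod (F n (fst z) - F n (snd z)) * cmod (f (fst z))
          \<le> (2 * indicator A (fst z) + 2 * indicator A (snd z)) * cmod (f (fst z))"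
          by (rule mult_right_mono) simp
        then show "norm ((F n (fst z) - F n (snd z)) * cnj (f (fst z)))
          \<le> 2 * (indicator A (fst z) * cmod (f (fst z))) + 2 * (indicator A (snd z) * cmod (f (fst z)))"
          by (simp only: norm_mult complex_mod_cnj distrib_right mult.assoc)
      qed
    qed simp_all
    have lim_mu: "(\<lambda>n. \<integral>x. F n x * cnj (f x) \<partial>mu) \<longlonglongrightarrow> (\<integral>x. u x * cnj (f x) \<partial>mu)"
    proof (rule integral_dominated_convergence)
      show "integrable mu (\<lambda>x. 2 * (indicator A x * cmod (f x)))" using im by simp
      show "AE x in mu. (\<lambda>n. F n x * cnj (f x)) \<longlonglongrightarrow> u x * cnj (f x)"
        by (intro AE_I2 tendsto_mult tendsto_const F(2))
      show "AE x in mu. norm (F n x * cnj (f x)) \<le> 2 * (indicator A x * cmod (f x))" for n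
      proof (rule AE_I2)
        fix x assume "x \<in> space mu"
        from mult_right_mono[OF F_le[OF this], of "cmod (f x)" n]
        show "norm (F n x * cnj (f x)) \<le> 2 * (indicator A x * cmod (f x))"
          by (simp only: norm_mult complex_mod_cnj mult.assoc norm_ge_zero)
      qed
    qed simp_all
    define M where "M = (\<integral>z. indicator A (fst z) * cmod (f (fst z)) \<partial>rho)"
    define m where "m = (\<integral>x. indicator A x * cmod (f x) \<partial>mu)"
    define w where "w = (\<integral>z. u (snd z) * cnj (f (fst z)) \<partial>rho)"
    have "(\<integral>z. (u (fst z) - u (snd z)) * cnj (f (fst z)) \<partial>rho) = cnj l * (\<integral>x. u x * cnj (f x) \<partial>mu)"
      using lim_rho tendsto_mult_left[OF lim_mu, of "cnj l"] unfolding weak[OF F(1)] by (rule LIMSEQ_unique)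
    also have "(\<integral>x. u x * cnj (f x) \<partial>mu) = complex_of_real m"
      unfolding u_f m_def by (rule integral_complex_of_real)
    finally have "(\<integral>z. (u (fst z) - u (snd z)) * cnj (f (fst z)) \<partial>rho) = cnj l * complex_of_real m" .
    moreover have "(\<integral>z. (u (fst z) - u (snd z)) * cnj (f (fst z)) \<partial>rho) = complex_of_real M - w"
    proof -
      have i: "integrable rho (\<lambda>z. u (snd z) * cnj (f (fst z)))"
      proof (rule Bochner_Integration.integrable_bound[OF iS])
        show "AE z in rho. norm (u (snd z) * cnj (f (fst z))) \<le> norm (indicator A (snd z) * cmod (f (fst z)))"
          using u_le by (auto simp: norm_mult intro!: mult_right_mono)
      qed measurable
      have "(\<integral>z. (u (fst z) - u (snd z)) * cnj (f (fst z)) \<partial>rho)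
        = (\<integral>z. complex_of_real (indicator A (fst z) * cmod (f (fst z))) - u (snd z) * cnj (f (fst z)) \<partial>rho)"
        by (simp only: left_diff_distrib u_f)
      also have "\<dots> = (\<integral>z. complex_of_real (indicator A (fst z) * cmod (f (fst z))) \<partial>rho) - w"
        unfolding w_def using iD i by (intro Bochner_Integration.integral_diff integrable_of_real)
      finally show ?thesis by (simp only: M_def integral_complex_of_real)
    qed
    ultimately have w_eq: "w = complex_of_real M - cnj l * complex_of_real m" by (simp add: algebra_simps)
    have w_le: "cmod w \<le> M"
    proof -
      have "cmod w \<le> (\<integral>z. norm (u (snd z) * cnj (f (fst z))) \<partial>rho)"
        unfolding w_def by (rule integral_norm_bound)
      also have "\<dots> \<le> (\<integral>z. indicator A (snd z) * cmod (f (fst z)) \<partial>rho)"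
        using u_le by (intro integral_mono_AE' iS AE_I2) (auto simp: norm_mult intro!: mult_right_mono)
      also have "\<dots> \<le> M"
        unfolding M_def A_def by (rule integral_level_set_swap_le[OF f e])
      finally show ?thesis .
    qed
    (* M is real and cnj l * m is imaginary, so w has modulus larger than M unless m = 0. *)
    have "(cmod w)\<^sup>2 = M\<^sup>2 + (Im l * m)\<^sup>2"
      unfolding w_eq cmod_power2 using l(1) by simp
    moreover have "(cmod w)\<^sup>2 \<le> M\<^sup>2" using w_le by (intro power_mono) auto
    ultimately have "(Im l * m)\<^sup>2 \<le> 0" by simp
    then have "Im l * m = 0" by simp
    then have "m = 0" using l by (simp add: complex_eq_iff)
    then have "AE x in mu. indicator A x * cmod (f x) = 0"
      using integral_nonneg_eq_0_iff_AE[OF im] by (simp add: m_def)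
    then show ?thesis
      using AE_space by eventually_elim (use e in \<open>auto simp: A_def indicator_def\<close>)
  qed
  have "AE x in mu. \<forall>n. \<not> 1 / real (Suc n) \<le> cmod (f x)"
    unfolding AE_all_countable using level by simp
  then show ?thesis
  proof eventually_elim
    case (elim x)
    show ?case
    proof (rule ccontr)
      assume "f x \<noteq> 0"
      then obtain n where "1 / real (Suc n) < cmod (f x)" using nat_approx_posE[of "cmod (f x)"] by auto
      with elim show False by (meson less_imp_le)
    qed
  qed
qed

theorem laplace_operator_essentially_self_adjoint:
  "essentially_self_adjoint mu (laplace_operator mu rk)"
  by (rule essentially_self_adjoint_if_deficiency_trivial[OF symmetric_laplace_operator])
    (erule adjoint_eigenfunction_zero; simp)+

end

theorem theorem7p7:
  fixes mu :: "'v measure" and rho :: "('v \<times> 'v) measure"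
    and rk :: "'v \<Rightarrow> 'v measure" and E :: "('v \<times> 'v) set"
  assumes "symmetric_measure_graph mu rho rk E"
    and "\<And>A. A \<in> sets mu \<Longrightarrow> emeasure mu A < \<infinity> \<Longrightarrow>
           integrable mu (\<lambda>x. measure (rk x) A) \<and>
           (\<lambda>x. complex_of_real (measure (rk x) A)) \<in> L2 mu"
    and "\<And>f. f \<in> D_fin mu \<Longrightarrow> graph_laplace rk f \<in> L2 mu"
  shows "essentially_self_adjoint mu (laplace_operator mu rk)"
proof -
  interpret square_integrable_graph mu rho rk E
    using assms by (intro square_integrable_graph.intro square_integrable_graph_axioms.intro) auto
  show ?thesis by (rule laplace_operator_essentially_self_adjoint)
qed

end
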